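(* Let $B$ be a finite direct power of $C_2$ of rank at least $2$, and let $$D=\{\lambda\in\mathbb R : \text{there exists }\omega\in\Omega\text{ with }\underline{\dim}(\omega)=2\text{ and }\dim_HG_\omega=\lambda\}.$$ Then the set $D$ contains transcendental elements.
   Context: Tree automorphisms. Let $X=\{0,1\}$ and let $\mathcal T$ be the infinite binary rooted tree, with vertices identified with the set $X^*$ of finite words over $X$. Every $g\in\operatorname{Aut}\mathcal T$ is written $g=\ll g@0,g@1\gg\tau$ with $g@x\in\operatorname{Aut}\mathcal T$ and $\tau\in\operatorname{Sym}(X)\cong C_2\cong\mathbb Z/2\mathbb Z$; it sends $xw$ to the letter $\tau(x)$ followed by the image of $w$ under $g@x$ ($\tau$ is omitted if trivial). For $G\le\operatorname{Aut}\mathcal T$, $\operatorname{Stab}_G(m)$ is the subgroup of elements fixing every vertex of $X^m$, and $(G\bmod m)=G/\operatorname{Stab}_G(m)$. The Hausdorff dimension of a subgroup $G$ is $\dim_HG=\liminf_{m\to\infty}\frac{\log_2|G\bmod m|}{2^m}$. Spinal groups. $B$ is viewed as a vector space over $\mathbb Z/2\mathbb Z$, with dual space $B^*$. $\Omega$ is the set of infinite sequences $\omega=\omega_1\omega_2\dots$ of non-trivial elements of $B^*$. Let $a\in\operatorname{Aut}\mathcal T$ be the involution exchanging the two maximal subtrees ($xw\mapsto(1-x)w$), and identify $\mathbb Z/2\mathbb Z$ with $\langle a\rangle$. Each $b\in B$ acts on $\mathcal T$ by $b=\ll\omega_1(b),b@1\gg$ and, recursively, $b@1^k=\ll\omega_{k+1}(b),b@1^{k+1}\gg$.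 The spinal group $G_\omega$ is the subgroup of $\operatorname{Aut}\mathcal T$ generated by $a$ and (the image of) $B$. Dimension of a sequence. The shift is $\sigma(\omega_1\omega_2\dots)=\omega_2\omega_3\dots$. For $m\ge1$, $\dim(\omega\bmod m)$ is the dimension of the span of the first $m-1$ terms of $\omega$, and $\underline{\dim}(\omega)=\liminf_{j\to\infty}\bigl(\lim_{m\to\infty}\dim(\sigma^j\omega\bmod m)\bigr)$. *)

theory Defs
  imports
    "HOL-Analysis.Analysis"
    "HOL-Library.Z2"
    "HOL-Library.Function_Algebras"
    "HOL-Computational_Algebra.Polynomial"
    "HOL-Algebra.Bij"
    "HOL-Algebra.Generated_Groups"
begin

text \<open>
  The alphabet is the field \<open>bit\<close> with two elements. This identifies \<open>Sym(X)\<close> with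
  \<open>bit\<close>: the permutation belonging to \<open>t\<close> is \<open>x \<mapsto> x + t\<close>. Vertices are finite words,
  and the children of \<open>u\<close> are the words \<open>u @ [x]\<close>.
\<close>

definition tree_aut :: "(bit list \<Rightarrow> bit list) set" where
  "tree_aut = {g. bij g \<and> g [] = [] \<and>
     (\<forall>u v. (\<exists>x. v = u @ [x]) \<longleftrightarrow> (\<exists>y. g v = g u @ [y]))}"

definition Aut_tree :: "(bit list \<Rightarrow> bit list) monoid" where
  "Aut_tree = (BijGroup UNIV)\<lparr>carrier := tree_aut\<rparr>"

text \<open>\<open>decomp g\<^sub>0 g\<^sub>1 t\<close> is the automorphism with sections \<open>g\<^sub>0\<close>, \<open>g\<^sub>1\<close> and permutation \<open>t\<close> at the root.\<close>

definition decomp ::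
  "(bit list \<Rightarrow> bit list) \<Rightarrow> (bit list \<Rightarrow> bit list) \<Rightarrow> bit \<Rightarrow> bit list \<Rightarrow> bit list" where
  "decomp g\<^sub>0 g\<^sub>1 t v = (case v of [] \<Rightarrow> [] | x # w \<Rightarrow> (x + t) # (if x = 0 then g\<^sub>0 w else g\<^sub>1 w))"

definition level_stab :: "(bit list \<Rightarrow> bit list) set \<Rightarrow> nat \<Rightarrow> (bit list \<Rightarrow> bit list) set" where
  "level_stab G m = {g \<in> G. \<forall>v. length v = m \<longrightarrow> g v = v}"

definition level_quot ::
  "(bit list \<Rightarrow> bit list) set \<Rightarrow> nat \<Rightarrow> (bit list \<Rightarrow> bit list) set monoid" where
  "level_quot G m = Aut_tree\<lparr>carrier := G\<rparr> Mod level_stab G m"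

definition hausdorff_dim :: "(bit list \<Rightarrow> bit list) set \<Rightarrow> ereal" where
  "hausdorff_dim G =
     liminf (\<lambda>m. ereal (log 2 (real (card (carrier (level_quot G m)))) / 2 ^ m))"

text \<open>
  The direct power of rank \<open>CARD('n)\<close> is \<open>bit ^ 'n\<close>. Its dual sits inside the space of all
  functions \<open>bit ^ 'n \<Rightarrow> bit\<close> with the pointwise operations, in which spans and dimensions
  are computed.
\<close>

definition fun_scale :: "bit \<Rightarrow> ('b \<Rightarrow> bit) \<Rightarrow> 'b \<Rightarrow> bit" where
  "fun_scale c f = (\<lambda>b. c * f b)"

interpretation bitfun: vector_space fun_scale
  by unfold_locales (auto simp: fun_scale_def fun_eq_iff algebra_simps)

definition dual_space :: "(bit ^ 'n \<Rightarrow> bit) set" where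
  "dual_space = {f. Vector_Spaces.linear (*s) (*) f}"

text \<open>Sequences are indexed from zero: \<open>\<omega> k\<close> is the term written \<open>\<omega>\<^sub>k\<^sub>+\<^sub>1\<close> in the usual notation.\<close>

definition Omega :: "(nat \<Rightarrow> bit ^ 'n \<Rightarrow> bit) set" where
  "Omega = {\<omega>. \<forall>k. \<omega> k \<in> dual_space - {0}}"

definition shift :: "(nat \<Rightarrow> 'c) \<Rightarrow> nat \<Rightarrow> 'c" where
  "shift \<omega> = (\<lambda>k. \<omega> (Suc k))"

text \<open>\<open>swap_pow t\<close> is the element of \<open>\<langle>a\<rangle>\<close> identified with \<open>t\<close>; in particular \<open>a = swap_pow 1\<close>.\<close>

definition swap_pow :: "bit \<Rightarrow> bit list \<Rightarrow> bit list" where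
  "swap_pow t = decomp id id t"

fun spinal_act :: "(nat \<Rightarrow> 'b \<Rightarrow> bit) \<Rightarrow> 'b \<Rightarrow> bit list \<Rightarrow> bit list" where
  "spinal_act \<omega> b [] = []"
| "spinal_act \<omega> b (x # w) =
     (if x = 0 then 0 # swap_pow (\<omega> 0 b) w else 1 # spinal_act (shift \<omega>) b w)"

lemma spinal_act_decomp:
  "spinal_act \<omega> b = decomp (swap_pow (\<omega> 0 b)) (spinal_act (shift \<omega>) b) 0"
proof
  fix v show "spinal_act \<omega> b v = decomp (swap_pow (\<omega> 0 b)) (spinal_act (shift \<omega>) b) 0 v"
    by (cases v) (auto simp: decomp_def)
qed

definition spinal_group :: "(nat \<Rightarrow> bit ^ 'n \<Rightarrow> bit) \<Rightarrow> (bit list \<Rightarrow> bit list) set" where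
  "spinal_group \<omega> = generate Aut_tree (insert (swap_pow 1) (range (spinal_act \<omega>)))"

text \<open>Only \<open>m \<ge> 1\<close> is meaningful here; the truncated value at \<open>m = 0\<close> does not affect the limit.\<close>

definition dim_mod :: "(nat \<Rightarrow> bit ^ 'n \<Rightarrow> bit) \<Rightarrow> nat \<Rightarrow> nat" where
  "dim_mod \<omega> m = bitfun.dim (bitfun.span (\<omega> ` {..<m - 1}))"

definition lower_dim :: "(nat \<Rightarrow> bit ^ 'n \<Rightarrow> bit) \<Rightarrow> enat" where
  "lower_dim \<omega> = liminf (\<lambda>j. lim (\<lambda>m. enat (dim_mod ((shift ^^ j) \<omega>) m)))"

end

theory Submission
  imports Defs
begin

text \<open>
  It suffices to use sequences with only two distinct terms, two coordinate functionals. For such a sequence,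
  with two-valued code \<open>s\<close>, the group modulo level \<open>m + 1\<close> is described by pairs of elements of the group of
  the shifted sequence modulo level \<open>m\<close>. Those pairs form a subgroup whose index is the order of a dihedral
  quotient, and this order depends only on whether the first two terms agree. Hence
  \<open>log\<^sub>2 |G\<^sub>\<omega> mod (m + 1)| = 2 log\<^sub>2 |G\<^sub>\<sigma>\<^sub>\<omega> mod m| - 2\<close>, minus \<open>1\<close> more when the first two terms agree,
  provided that \<open>m \<ge> 4\<close> and repetitions are at least three steps apart.

  Iterating, \<open>log\<^sub>2 |G\<^sub>\<omega> mod m| / 2 ^ m\<close> is, up to a null sequence and a term determined by the presence of
  repetitions near \<open>m\<close>, a binary expansion read backwards from \<open>m\<close> whose digits mark the repetitions.
  Placing ever longer reversed initial pieces of a binary pattern in front of the squares makes the lower limit a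
  strictly decreasing function of the number coded by the pattern. Uncountably many patterns give uncountably many
  dimensions, while there are only countably many algebraic numbers.
\<close>

section \<open>Groups generated by three involutions\<close>

fun alternating :: "nat \<Rightarrow> 'g::monoid_mult \<Rightarrow> 'g::monoid_mult \<Rightarrow> 'g::monoid_mult" where
  "alternating 0 a d = 1"
| "alternating (Suc n) a d = a * alternating n d a"

text \<open>For involutions \<open>a\<close>, \<open>c\<close>, \<open>d\<close> no inverses are needed: this monoid is already a group.\<close>

inductive_set gen_group :: "'g::monoid_mult \<Rightarrow> 'g::monoid_mult \<Rightarrow> 'g::monoid_mult \<Rightarrow> 'g set" for a c d where
  gen_group_one: "1 \<in> gen_group a c d"
| gen_group_step: "x \<in> {a, c, d} \<Longrightarrow> g \<in> gen_group a c d \<Longrightarrow> x * g \<in> gen_group a c d"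

text \<open>In a monoid the conjugating inverse has to be supplied as a second element
  \<open>g'\<close>. When \<open>a\<close>, \<open>c\<close>, \<open>d\<close> are involutions, a
  right inverse in the generated group is the two-sided inverse.\<close>

inductive_set normal_closure :: "'g::monoid_mult \<Rightarrow> 'g::monoid_mult \<Rightarrow> 'g::monoid_mult \<Rightarrow> 'g set" for a c d where
  normal_closure_one: "1 \<in> normal_closure a c d"
| normal_closure_step: "g \<in> gen_group a c d \<Longrightarrow> g' \<in> gen_group a c d \<Longrightarrow> g * g' = 1 \<Longrightarrow>
    l \<in> normal_closure a c d \<Longrightarrow> g * c * g' * l \<in> normal_closure a c d"

text \<open>
  If \<open>a\<close>, \<open>c\<close>, \<open>d\<close> generate the sections on the first level, these are the pairs of sections of the
  elements fixing the first level.
\<close>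

inductive_set twin_group :: "'g::monoid_mult \<Rightarrow> 'g::monoid_mult \<Rightarrow> 'g::monoid_mult \<Rightarrow> ('g \<times> 'g) set"
  for a c d where
  twin_group_one: "(1, 1) \<in> twin_group a c d"
| twin_group_step: "(x, y) \<in> {(1, c), (c, 1), (a, d), (d, a)} \<Longrightarrow> (g, h) \<in> twin_group a c d \<Longrightarrow>
    (x * g, y * h) \<in> twin_group a c d"

lemma inverse_unique_monoid:
  fixes x :: "'g::monoid_mult"
  assumes "x * y = 1" "y * z = 1"
  shows "x = z"
proof -
  have "x = x * (y * z)" using assms by simp
  also have "\<dots> = (x * y) * z" by (simp only: mult.assoc)
  finally show ?thesis using assms by simp
qed

lemma mult_cancel_invertible:
  fixes x :: "'g::monoid_mult"
  assumes "x * z = y * z" "z * w = 1"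
  shows "x = y"
proof -
  have "x = x * (z * w)" using assms by simp
  also have "\<dots> = (x * z) * w" by (simp only: mult.assoc)
  also have "\<dots> = (y * z) * w" using assms by simp
  also have "\<dots> = y * (z * w)" by (simp only: mult.assoc)
  finally show ?thesis using assms by simp
qed

section \<open>Words in two alternating letters\<close>

text \<open>After an odd number of letters the continuation starts with the other letter, hence the
  parity split.\<close>

lemma alternating_add:
  "alternating (m + n) a d = alternating m a d * (if even m then alternating n a d else alternating n d a)"
  by (induction m arbitrary: a d) (auto simp: mult.assoc)

lemma alternating_mod:
  assumes "alternating p a d = 1" "even p"
  shows "alternating n a d = alternating (n mod p) a d"
proof -
  have "alternating (p * k + j) a d = alternating j a d" for k j
  proof (induction k)
    case (Suc k)
    have "alternating (p * Suc k + j) a d = alternating p a d * alternating (p * k + j) a d"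
      using assms(2) alternating_add[of p "p * k + j" a d] by (simp add: add.assoc)
    then show ?case using Suc assms by simp
  qed simp
  from this[of "n div p" "n mod p"] show ?thesis by simp
qed

section \<open>Inverses, conjugation and reversal of words for three involutions\<close>

locale three_involutions =
  fixes a c d :: "'a::monoid_mult"
  assumes aa: "a * a = 1" and cc: "c * c = 1" and dd: "d * d = 1"
begin

lemma cancel [simp]: "a * (a * g) = g" "c * (c * g) = g" "d * (d * g) = g"
  by (simp_all add: mult.assoc[symmetric] aa cc dd)

abbreviation "Gr \<equiv> gen_group a c d"
abbreviation "Nc \<equiv> normal_closure a c d"
abbreviation "Tw \<equiv> twin_group a c d"
abbreviation "word n \<equiv> alternating n a d"
abbreviation "coword n \<equiv> alternating n d a"

lemma Gr_comp: "g \<in> Gr \<Longrightarrow> h \<in> Gr \<Longrightarrow> g * h \<in> Gr"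
  by (induction rule: gen_group.induct) (auto simp: mult.assoc intro: gen_group.intros)

lemma Gr_gens: "a \<in> Gr" "c \<in> Gr" "d \<in> Gr"
  using gen_group_step[OF _ gen_group_one, of _ a c d] by auto

lemma Gr_inverse: "g \<in> Gr \<Longrightarrow> \<exists>h\<in>Gr. g * h = 1 \<and> h * g = 1"
proof (induction rule: gen_group.induct)
  case gen_group_one
  then show ?case by (auto intro: gen_group.intros)
next
  case (gen_group_step x g)
  then obtain h where h: "h \<in> Gr" "g * h = 1" "h * g = 1" by auto
  have xx: "x * x = 1" using gen_group_step aa cc dd by auto
  have "(x * g) * (h * x) = x * (g * h) * x" by (simp add: mult.assoc)
  moreover have "(h * x) * (x * g) = h * (x * x) * g" by (simp add: mult.assoc)
  moreover have "h * x \<in> Gr" using h gen_group_step Gr_gens by (auto intro: Gr_comp)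
  ultimately show ?case using h xx by (intro bexI[of _ "h * x"]) auto
qed

lemma Nc_comp: "l \<in> Nc \<Longrightarrow> l' \<in> Nc \<Longrightarrow> l * l' \<in> Nc"
proof (induction rule: normal_closure.induct)
  case (normal_closure_step g g' l)
  then have "g * c * g' * (l * l') \<in> Nc" by (intro normal_closure.intros) auto
  then show ?case by (simp add: mult.assoc)
qed (auto intro: normal_closure.intros)

lemma Nc_conj: "l \<in> Nc \<Longrightarrow> h \<in> Gr \<Longrightarrow> h' \<in> Gr \<Longrightarrow> h * h' = 1 \<Longrightarrow> h' * h = 1 \<Longrightarrow> h * l * h' \<in> Nc"
proof (induction rule: normal_closure.induct)
  case (normal_closure_step g g' l)
  have "(h * g) * (g' * h') = h * (g * g') * h'" by (simp add: mult.assoc)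
  then have "(h * g) * c * (g' * h') * (h * l * h') \<in> Nc"
    using normal_closure_step by (intro normal_closure.intros Gr_comp) auto
  also have "(h * g) * c * (g' * h') * (h * l * h') = h * g * c * g' * (h' * h) * l * h'"
    by (simp only: mult.assoc)
  finally show ?case using normal_closure_step by (simp add: mult.assoc)
qed (auto intro: normal_closure.intros)

text \<open>Normality in the form used for normal forms: factors from \<open>Nc\<close> can be
  collected on the left.\<close>

lemma Nc_conj_right:
  assumes "l \<in> Nc" "g \<in> Gr"
  shows "\<exists>l'\<in>Nc. g * l = l' * g"
proof -
  obtain h where h: "h \<in> Gr" "g * h = 1" "h * g = 1" using Gr_inverse assms by blast
  have "g * l * h * g = g * l * (h * g)" by (simp add: mult.assoc)
  then show ?thesis using Nc_conj[OF assms h] h by (intro bexI[of _ "g * l * h"]) auto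
qed

lemma Nc_c: "c \<in> Nc"
  using normal_closure_step[OF gen_group_one gen_group_one _ normal_closure_one, where c = c] by simp

lemma Nc_inverse: "l \<in> Nc \<Longrightarrow> \<exists>l'\<in>Nc. l * l' = 1 \<and> l' * l = 1"
proof (induction rule: normal_closure.induct)
  case (normal_closure_step g g' l)
  then obtain l' where l': "l' \<in> Nc" "l * l' = 1" "l' * l = 1" by auto
  obtain h where h: "h \<in> Gr" "g * h = 1" "h * g = 1"
    using Gr_inverse normal_closure_step by blast
  have hg: "h = g'"
    using inverse_unique_monoid h normal_closure_step by blast
  let ?x = "g * c * g'"
  have "g * c * g' * 1 \<in> Nc" using normal_closure_step by (intro normal_closure.intros) auto
  then have x: "?x \<in> Nc" by simp
  have "?x * ?x = g * c * (g' * g) * c * g'" by (simp only: mult.assoc)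
  also have "\<dots> = g * c * 1 * c * g'" using h hg by simp
  also have "\<dots> = g * (c * c) * g'" by (simp only: mult.assoc mult_1_right mult_1_left)
  finally have xx: "?x * ?x = 1" using normal_closure_step by (simp add: cc)
  have "?x * l * (l' * ?x) = ?x * (l * l') * ?x" "(l' * ?x) * (?x * l) = l' * (?x * ?x) * l"
    by (simp_all only: mult.assoc)
  then show ?case using x xx l' Nc_comp by (intro bexI[of _ "l' * ?x"]) auto
qed (auto intro: normal_closure.intros)

lemma word_Gr: "word n \<in> Gr \<and> coword n \<in> Gr"
  by (induction n) (auto intro: gen_group.intros)

text \<open>The inverse of a word in involutions is its reversal. An alternating word of odd length
  is a palindrome; one of even length reverses to the word with the other first letter.\<close>

lemma coword_word_cancel:
  "word n * (if even n then coword n else word n) = 1"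
  "coword n * (if even n then word n else coword n) = 1"
proof (induction n)
  case (Suc n)
  have e: "word (Suc n) = word n * (if even n then a else d)"
          "coword (Suc n) = coword n * (if even n then d else a)"
    using alternating_add[of n 1 a d] alternating_add[of n 1 d a] by auto
  {
    case 1
    have "word (Suc n) * (if even (Suc n) then coword (Suc n) else word (Suc n)) =
      word n * (if even n then a else d) * (if even n then a * coword n else d * word n)"
      by (subst e(1)) simp
    then show ?case using Suc by (cases "even n") (auto simp: mult.assoc)
  next
    case 2
    have "coword (Suc n) * (if even (Suc n) then word (Suc n) else coword (Suc n)) =
      coword n * (if even n then d else a) * (if even n then d * word n else a * coword n)"
      by (subst e(2)) simp
    then show ?case using Suc by (cases "even n") (auto simp: mult.assoc)
  }
qed simp_all

end

section \<open>Dihedral quotients and the counting of twins\<close>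

text \<open>Here \<open>p\<close> is the order of the quotient of \<open>Gr\<close> by
  \<open>Nc\<close>. Since \<open>word p\<close> is trivial in \<open>Gr\<close> itself,
  \<open>a\<close> and \<open>d\<close> generate a dihedral complement of \<open>Nc\<close>.\<close>

locale dihedral_involutions = three_involutions +
  fixes p :: nat
  assumes p: "p > 0" "even p"
    and word_p: "alternating p a d = 1"
    and word_Nc: "alternating n a d \<in> normal_closure a c d \<Longrightarrow> p dvd n"
begin

lemma coword_p: "coword p = 1"
  using coword_word_cancel(1)[of p] word_p p by simp

text \<open>The dihedral elements lie on a closed path of length \<open>p\<close>: going
  \<open>j\<close> steps in one direction ends where \<open>p - j\<close> steps in the other
  direction end.\<close>

lemma coword_eq_word: "\<exists>i<p. coword n = word i"
proof -
  have n: "coword n = coword (n mod p)" using alternating_mod coword_p p by blast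
  show ?thesis
  proof (cases "n mod p = 0")
    case True
    then show ?thesis using n p by (intro exI[of _ 0]) simp
  next
    case False
    let ?j = "n mod p"
    have j: "?j < p" "?j > 0" using False p by auto
    have "1 = coword (?j + (p - ?j))" using coword_p j by simp
    also have "\<dots> = coword ?j * (if even ?j then coword (p - ?j) else word (p - ?j))"
      by (rule alternating_add)
    finally have e: "coword ?j * (if even ?j then coword (p - ?j) else word (p - ?j)) = 1" by simp
    let ?x = "if even ?j then coword (p - ?j) else word (p - ?j)"
    \<comment> \<open>As \<open>p\<close> is even, both pieces have the same parity, so
      \<open>?x\<close> is exactly the reversal of \<open>word (p - ?j)\<close>.\<close>
    have ev: "even (p - ?j) \<longleftrightarrow> even ?j" using p j by simp
    have "?x * word (p - ?j) = 1"
      using ev coword_word_cancel[of "p - ?j"] by (auto split: if_splits)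
    then have "coword ?j = word (p - ?j)" using e inverse_unique_monoid by blast
    then show ?thesis using n j by (intro exI[of _ "p - ?j"]) simp
  qed
qed

lemma word_reduce: "\<exists>i<p. word n = word i"
  using alternating_mod[OF word_p] p by (intro exI[of _ "n mod p"]) auto

text \<open>Conjugation by \<open>a\<close> reduces to words starting with \<open>a\<close>. For odd
  \<open>n\<close> it yields a word of odd length \<open>n + 2\<close>, which the even number
  \<open>p\<close> cannot divide.\<close>

lemma coword_Nc: "coword n \<in> Nc \<Longrightarrow> p dvd n"
proof -
  assume n: "coword n \<in> Nc"
  have m: "a * coword n * a \<in> Nc" using Nc_conj[OF n Gr_gens(1) Gr_gens(1)] aa by simp
  show ?thesis
  proof (cases "even n")
    case True
    then have "a * coword n * a = word n * a * a" using alternating_add[of n 1 a d] by simp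
    then show ?thesis using m word_Nc[of n] aa by (simp add: mult.assoc)
  next
    case False
    then have "a * coword n * a = word (Suc (Suc n))" using alternating_add[of "Suc n" 1 a d] by simp
    then have "p dvd Suc (Suc n)" using m word_Nc[of "Suc (Suc n)"] by (simp only:)
    then have "even (Suc (Suc n))" using p(2) dvd_trans by blast
    then show ?thesis using False by simp
  qed
qed

text \<open>A generator \<open>c\<close> is absorbed by the \<open>Nc\<close> factor;
  \<open>a\<close> and \<open>d\<close> are moved past it and then shift the word along the closed
  path.\<close>

lemma Gr_form: "g \<in> Gr \<Longrightarrow> \<exists>l\<in>Nc. \<exists>i<p. g = l * word i"
proof (induction rule: gen_group.induct)
  case gen_group_one
  show ?case using p by (intro bexI[of _ 1] exI[of _ 0]) (auto intro: normal_closure_one)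
next
  case (gen_group_step x g)
  then obtain l i where l: "l \<in> Nc" "i < p" "g = l * word i" by auto
  consider "x = c" | "x = a" | "x = d" using gen_group_step by auto
  then show ?case
  proof cases
    case 1
    then show ?thesis using l Nc_comp[OF Nc_c] by (auto simp: mult.assoc[symmetric])
  next
    case 2
    obtain l' where l': "l' \<in> Nc" "a * l = l' * a" using Nc_conj_right[OF l(1) Gr_gens(1)] by blast
    have "a * word i = coword (i - 1) \<or> a * word i = word (Suc i)"
      by (cases i) auto
    then obtain j where j: "j < p" "a * word i = word j"
      using coword_eq_word word_reduce by metis
    have "x * g = (a * l) * word i" using 2 l by (simp only: mult.assoc)
    then have "x * g = l' * word j" using l' j by (simp add: mult.assoc)
    then show ?thesis using l' j by auto
  next
    case 3
    obtain l' where l': "l' \<in> Nc" "d * l = l' * d" using Nc_conj_right[OF l(1) Gr_gens(3)] by blast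
    have "d * word i = coword (Suc i)" by simp
    then obtain j where j: "j < p" "d * word i = word j"
      using coword_eq_word by metis
    have "x * g = (d * l) * word i" using 3 l by (simp only: mult.assoc)
    then have "x * g = l' * word j" using l' j by (simp add: mult.assoc)
    then show ?thesis using l' j by auto
  qed
qed

text \<open>The graph of the automorphism of the dihedral group that exchanges \<open>a\<close> and
  \<open>d\<close>.\<close>

definition word_pairs :: "('a \<times> 'a) set" where
  "word_pairs = (\<Union>n. {(word n, coword n), (coword n, word n)})"

lemma word_pairs_iff: "(u, v) \<in> word_pairs \<longleftrightarrow> (\<exists>n. u = word n \<and> v = coword n \<or> u = coword n \<and> v = word n)"
  by (auto simp: word_pairs_def)

lemma word_pairs_swap: "(u, v) \<in> word_pairs \<Longrightarrow> (v, u) \<in> word_pairs"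
  by (auto simp: word_pairs_def)

lemma word_pairs_step:
  assumes "(u, v) \<in> word_pairs"
  shows "(a * u, d * v) \<in> word_pairs"
proof -
  obtain n where n: "u = word n \<and> v = coword n \<or> u = coword n \<and> v = word n"
    using assms word_pairs_iff by blast
  show ?thesis
  proof (cases "u = coword n \<and> v = word n")
    case True
    then have "a * u = word (Suc n)" "d * v = coword (Suc n)" by simp_all
    then show ?thesis using word_pairs_iff by blast
  next
    case False
    then have uv: "u = word n" "v = coword n" using n by blast+
    show ?thesis
    proof (cases n)
      case 0
      then have "a * u = word 1" "d * v = coword 1" using uv by simp_all
      then show ?thesis using word_pairs_iff by blast
    next
      case (Suc k)
      then have "a * u = coword k" "d * v = word k" using uv by simp_all
      then show ?thesis using word_pairs_iff by blast
    qed
  qed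
qed

text \<open>Modulo \<open>Nc\<close> in both components, each generator of \<open>Tw\<close> is
  trivial or exchanges the roles of \<open>a\<close> and \<open>d\<close>, so twins lie on the graph
  \<open>word_pairs\<close>.\<close>

lemma Tw_form:
  "(g, h) \<in> Tw \<Longrightarrow> \<exists>l\<in>Nc. \<exists>l'\<in>Nc. \<exists>u v. (u, v) \<in> word_pairs \<and> g = l * u \<and> h = l' * v"
proof (induction rule: twin_group.induct)
  case twin_group_one
  have "(1, 1) \<in> word_pairs" unfolding word_pairs_iff by (rule exI[of _ 0]) simp
  then show ?case by (intro bexI[of _ 1] exI[of _ 1]) (auto intro: normal_closure.intros)
next
  case (twin_group_step x y g h)
  then obtain l l' u v where l: "l \<in> Nc" "l' \<in> Nc"
    and uv: "(u, v) \<in> word_pairs" and gh: "g = l * u" "h = l' * v" by blast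
  have conj: "\<exists>k\<in>Nc. z * l = k * z" "\<exists>k\<in>Nc. z * l' = k * z" if "z \<in> {a, d}" for z
    using Nc_conj_right[OF l(1)] Nc_conj_right[OF l(2)] Gr_gens that by auto
  consider "x = 1" "y = c" | "x = c" "y = 1" | "x = a" "y = d" | "x = d" "y = a"
    using twin_group_step by auto
  then show ?case
  proof cases
    case 1
    then have "x * g = l * u" "y * h = (c * l') * v" using gh by (simp_all add: mult.assoc)
    then show ?thesis using uv l(1) Nc_comp[OF Nc_c l(2)] by blast
  next
    case 2
    then have "x * g = (c * l) * u" "y * h = l' * v" using gh by (simp_all add: mult.assoc)
    then show ?thesis using uv l(2) Nc_comp[OF Nc_c l(1)] by blast
  next
    case 3
    obtain k k' where k: "k \<in> Nc" "a * l = k * a" "k' \<in> Nc" "d * l' = k' * d" using conj by blast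
    have "x * g = (a * l) * u" "y * h = (d * l') * v" using 3 gh by (simp_all only: mult.assoc)
    then have "x * g = k * (a * u)" "y * h = k' * (d * v)" using k by (simp_all add: mult.assoc)
    then show ?thesis using k(1,3) word_pairs_step[OF uv] by blast
  next
    case 4
    obtain k k' where k: "k \<in> Nc" "d * l = k * d" "k' \<in> Nc" "a * l' = k' * a" using conj by blast
    have "x * g = (d * l) * u" "y * h = (a * l') * v" using 4 gh by (simp_all only: mult.assoc)
    then have "x * g = k * (d * u)" "y * h = k' * (a * v)" using k by (simp_all add: mult.assoc)
    then show ?thesis using k(1,3) word_pairs_swap[OF word_pairs_step[OF word_pairs_swap[OF uv]]] by blast
  qed
qed

text \<open>The dihedral part \<open>u\<close> lies in \<open>Nc\<close>, so its length is a
  multiple of \<open>p\<close>, and then its partner \<open>v\<close> is trivial as well.\<close>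

lemma Tw_one_left:
  assumes "(1, h) \<in> Tw"
  shows "h \<in> Nc"
proof -
  obtain l l' u v where l: "l \<in> Nc" "l' \<in> Nc" and uv: "(u, v) \<in> word_pairs" and gh: "1 = l * u" "h = l' * v"
    using Tw_form[OF assms] by blast
  obtain k where k: "k \<in> Nc" "k * l = 1" using Nc_inverse l by blast
  then have u: "u \<in> Nc" using gh inverse_unique_monoid[of k l u] by simp
  obtain n where n: "u = word n \<and> v = coword n \<or> u = coword n \<and> v = word n"
    using uv word_pairs_iff by blast
  then have "p dvd n" using u word_Nc[of n] coword_Nc[of n] by blast
  then have m: "n mod p = 0" by (rule dvd_imp_mod_0)
  have "word n = 1" "coword n = 1"
    using alternating_mod[OF word_p p(2), of n] alternating_mod[OF coword_p p(2), of n] m by simp_all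
  then have "v = 1" using n by metis
  then show ?thesis using gh l by simp
qed

lemma Tw_comp: "(g, h) \<in> Tw \<Longrightarrow> (g', h') \<in> Tw \<Longrightarrow> (g * g', h * h') \<in> Tw"
proof (induction rule: twin_group.induct)
  case (twin_group_step x y g h)
  then have "(x * (g * g'), y * (h * h')) \<in> Tw"
    using twin_group.twin_group_step by blast
  then show ?case by (simp add: mult.assoc)
qed auto

lemma Tw_gens: "(1, c) \<in> Tw" "(a, d) \<in> Tw" "(d, a) \<in> Tw" "(c, 1) \<in> Tw"
  using twin_group_step[OF _ twin_group_one, of _ _ c a d] by auto

lemma Tw_inverse: "(g, h) \<in> Tw \<Longrightarrow> \<exists>g' h'. (g', h') \<in> Tw \<and> g * g' = 1 \<and> h * h' = 1 \<and> g' * g = 1 \<and> h' * h = 1"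
proof (induction rule: twin_group.induct)
  case (twin_group_step x y g h)
  then obtain g' h' where gh: "(g', h') \<in> Tw" "g * g' = 1" "h * h' = 1" "g' * g = 1" "h' * h = 1" by auto
  have xy: "(x, y) \<in> Tw" using twin_group_step Tw_gens by auto
  have e: "x * x = 1" "y * y = 1" using twin_group_step aa cc dd by auto
  have "(x * g) * (g' * x) = x * (g * g') * x" "(y * h) * (h' * y) = y * (h * h') * y"
    "(g' * x) * (x * g) = g' * (x * x) * g" "(h' * y) * (y * h) = h' * (y * y) * h"
    by (simp_all only: mult.assoc)
  then show ?case using gh e Tw_comp[OF gh(1) xy]
    by (intro exI[of _ "g' * x"] exI[of _ "h' * y"]) auto
qed (auto intro: twin_group.intros)

lemma Tw_subset: "(g, h) \<in> Tw \<Longrightarrow> g \<in> Gr \<and> h \<in> Gr"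
  by (induction rule: twin_group.induct) (auto intro: gen_group.intros)

lemma Tw_project: "g \<in> Gr \<Longrightarrow> \<exists>h. (g, h) \<in> Tw"
proof (induction rule: gen_group.induct)
  case (gen_group_step x g)
  then obtain h where "(g, h) \<in> Tw" by auto
  moreover obtain y where "(x, y) \<in> Tw" using gen_group_step Tw_gens by auto
  ultimately show ?case using Tw_comp by blast
qed (auto intro: twin_group.intros)

lemma Tw_project_right: "g \<in> Gr \<Longrightarrow> \<exists>h. (h, g) \<in> Tw"
proof (induction rule: gen_group.induct)
  case (gen_group_step x g)
  then obtain h where "(h, g) \<in> Tw" by auto
  moreover obtain y where "(y, x) \<in> Tw" using gen_group_step Tw_gens by auto
  ultimately show ?case using Tw_comp by blast
qed (auto intro: twin_group.intros)

text \<open>The second projection of \<open>Tw\<close> is onto \<open>Gr\<close>, so conjugating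
  \<open>(1, c)\<close> inside \<open>Tw\<close> yields every conjugate of \<open>c\<close> in the
  second component.\<close>

lemma Tw_Nc: "l \<in> Nc \<Longrightarrow> (1, l) \<in> Tw"
proof (induction rule: normal_closure.induct)
  case (normal_closure_step g g' l)
  obtain h where h: "(h, g) \<in> Tw" using Tw_project_right normal_closure_step by blast
  then obtain h' k where k: "(h', k) \<in> Tw" "h * h' = 1" "g * k = 1" "k * g = 1"
    using Tw_inverse by blast
  have "k = g'" using k normal_closure_step inverse_unique_monoid by blast
  then have "(h * 1 * h' * 1, g * c * g' * l) \<in> Tw"
    using k h normal_closure_step Tw_gens by (intro Tw_comp) auto
  then show ?case using k by simp
qed (auto intro: twin_group.intros)

text \<open>
  Multiplying the second component of a twin by the \<open>p\<close> dihedral words reaches every pair exactly once,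
  because the dihedral words are a transversal of the normal closure of \<open>c\<close> and the twins with trivial first
  component are exactly that normal closure.
\<close>

theorem card_twin_group:
  "card Tw * p = card Gr * card Gr"
proof -
  let ?f = "\<lambda>((g, h), i). (g, h * word i)"
  have "bij_betw ?f (Tw \<times> {..<p}) (Gr \<times> Gr)"
  proof (rule bij_betw_imageI)
    show "inj_on ?f (Tw \<times> {..<p})"
    proof (clarsimp simp: inj_on_def)
      fix g h i h' i'
      assume A: "(g, h) \<in> Tw" "(g, h') \<in> Tw" "i < p" "i' < p" and e: "h * word i = h' * word i'"
      obtain k k' where k: "(k, k') \<in> Tw" "k * g = 1" "k' * h = 1" "h * k' = 1"
        using Tw_inverse[OF A(1)] by blast
      have "(k * g, k' * h') \<in> Tw" using Tw_comp k A by blast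
      then have n: "k' * h' \<in> Nc" using k Tw_one_left by simp
      have "k' * h' * word i' = k' * h * word i" using e by (simp add: mult.assoc)
      then have w: "word i = (k' * h') * word i'" using k by simp
      \<comment> \<open>The reversal, hence the inverse, of \<open>word i'\<close>.\<close>
      define rest where "rest = (if even i' then coword i' else word i')"
      have r: "word i' * rest = 1" unfolding rest_def by (rule coword_word_cancel)
      have nr: "word i * rest \<in> Nc" using w r n by (simp add: mult.assoc)
      have "i = i'"
      proof (cases "even i = even i'")
        case False
        \<comment> \<open>With different parities nothing cancels, and the result is a word of odd
          length.\<close>
        then have "word i * rest = word (i + i')"
          by (auto simp: alternating_add rest_def)
        then have "p dvd i + i'" using nr word_Nc by simp
        then have "even (i + i')" using p dvd_trans by blast
        then show ?thesis using False by auto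
      next
        case True
        \<comment> \<open>With equal parities the shorter word is a suffix of the longer one; the
          quotient is a word of length below \<open>p\<close> lying in \<open>Nc\<close>.\<close>
        consider "i \<le> i'" | "i' \<le> i" by linarith
        then show ?thesis
        proof cases
          case 1
          have "word i' = word (i' - i) * word i"
            using alternating_add[of "i' - i" i a d] 1 True by simp
          moreover obtain v where v: "v \<in> Nc" "v * (k' * h') = 1" using Nc_inverse[OF n] by blast
          moreover have "v * word i = (v * (k' * h')) * word i'"
            by (subst w) (simp only: mult.assoc)
          ultimately have "v * word i = word (i' - i) * word i"
            by simp
          moreover obtain z where "word i * z = 1" using Gr_inverse word_Gr by blast
          ultimately have "v = word (i' - i)" by (rule mult_cancel_invertible)
          then have "p dvd i' - i" using v word_Nc by simp
          then show ?thesis using 1 A by (auto dest: dvd_imp_le)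
        next
          case 2
          have "word i = word (i - i') * word i'"
            using alternating_add[of "i - i'" i' a d] 2 True by simp
          then have "word i * rest = word (i - i')" using r by (simp add: mult.assoc)
          then have "p dvd i - i'" using nr word_Nc by simp
          then show ?thesis using 2 A by (auto dest: dvd_imp_le)
        qed
      qed
      moreover have "h = h'"
      proof -
        obtain z where "word i * z = 1" using Gr_inverse word_Gr by blast
        then show ?thesis using e \<open>i = i'\<close> mult_cancel_invertible by blast
      qed
      ultimately show "h = h' \<and> i = i'" by simp
    qed
    show "?f ` (Tw \<times> {..<p}) = Gr \<times> Gr"
    proof (intro equalityI subsetI)
      fix x assume "x \<in> ?f ` (Tw \<times> {..<p})"
      then show "x \<in> Gr \<times> Gr" using Tw_subset word_Gr by (auto intro: Gr_comp)
    next
      fix x assume "x \<in> Gr \<times> Gr"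
      then obtain g h where x: "x = (g, h)" "g \<in> Gr" "h \<in> Gr" by auto
      \<comment> \<open>Start from any twin above \<open>g\<close>. The inverse of \<open>h0\<close>
        times \<open>h\<close> has a normal form, and its \<open>Nc\<close> factor can be absorbed
        into the twin.\<close>
      obtain h0 where h0: "(g, h0) \<in> Tw" using Tw_project x by blast
      then obtain k where k: "k \<in> Gr" "h0 * k = 1" using Gr_inverse Tw_subset by blast
      obtain l i where l: "l \<in> Nc" "i < p" "k * h = l * word i" using Gr_form Gr_comp[OF k(1) x(3)] by blast
      have "(g * 1, h0 * l) \<in> Tw" using Tw_comp[OF h0 Tw_Nc[OF l(1)]] .
      moreover have "h = h0 * l * word i"
      proof -
        have "h = (h0 * k) * h" using k by simp
        then show ?thesis using l by (simp add: mult.assoc)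
      qed
      ultimately have "((g, h0 * l), i) \<in> Tw \<times> {..<p}" "x = ?f ((g, h0 * l), i)" using x l by simp_all
      then show "x \<in> ?f ` (Tw \<times> {..<p})" by blast
    qed
  qed
  then have "card (Tw \<times> {..<p}) = card (Gr \<times> Gr)" by (rule bij_betw_same_card)
  then show ?thesis by (simp add: card_cartesian_product)
qed

end

section \<open>Level quotients of a two-letter spinal group\<close>

text \<open>Wrapping the maps makes composition available as multiplication of a \<open>monoid_mult\<close>.\<close>

typedef tree_map = "UNIV :: (bit list \<Rightarrow> bit list) set" morphisms apply_map Map
  by simp

lemmas tree_map_simps [simp] = Map_inverse[OF UNIV_I] apply_map_inverse Map_inject[OF UNIV_I UNIV_I]

instantiation tree_map :: monoid_mult
begin
definition "1 = Map id"
definition "g * h = Map (apply_map g \<circ> apply_map h)"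
instance by standard (simp_all add: one_tree_map_def times_tree_map_def comp_assoc)
end

section \<open>Multiplication of tree maps through their sections\<close>

definition node :: "tree_map \<Rightarrow> tree_map \<Rightarrow> bit \<Rightarrow> tree_map" where
  "node g\<^sub>0 g\<^sub>1 t = Map (decomp (apply_map g\<^sub>0) (apply_map g\<^sub>1) t)"

lemma bit_cases: "(t::bit) = 0 \<or> t = 1"
  by (cases t) auto

lemma UNIV_bit_eq: "(UNIV :: bit set) = {0, 1}"
  using bit_cases by auto

lemma decomp_comp:
  "decomp g\<^sub>0 g\<^sub>1 t \<circ> decomp h\<^sub>0 h\<^sub>1 s =
     decomp ((if s = 0 then g\<^sub>0 else g\<^sub>1) \<circ> h\<^sub>0) ((if s = 0 then g\<^sub>1 else g\<^sub>0) \<circ> h\<^sub>1) (s + t)"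
proof
  fix v show "(decomp g\<^sub>0 g\<^sub>1 t \<circ> decomp h\<^sub>0 h\<^sub>1 s) v =
     decomp ((if s = 0 then g\<^sub>0 else g\<^sub>1) \<circ> h\<^sub>0) ((if s = 0 then g\<^sub>1 else g\<^sub>0) \<circ> h\<^sub>1) (s + t) v"
  proof (cases v)
    case (Cons x w)
    then show ?thesis using bit_cases[of x] bit_cases[of s] bit_cases[of t] by (auto simp: decomp_def)
  qed (simp add: decomp_def)
qed

lemma decomp_id: "decomp id id 0 = id"
  by (auto simp: decomp_def fun_eq_iff split: list.splits)

lemma decomp_inject: "decomp g\<^sub>0 g\<^sub>1 t = decomp h\<^sub>0 h\<^sub>1 s \<longleftrightarrow> g\<^sub>0 = h\<^sub>0 \<and> g\<^sub>1 = h\<^sub>1 \<and> t = s"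
proof
  assume e: "decomp g\<^sub>0 g\<^sub>1 t = decomp h\<^sub>0 h\<^sub>1 s"
  have "decomp g\<^sub>0 g\<^sub>1 t (0 # w) = decomp h\<^sub>0 h\<^sub>1 s (0 # w)" "decomp g\<^sub>0 g\<^sub>1 t (1 # w) = decomp h\<^sub>0 h\<^sub>1 s (1 # w)" for w
    by (simp_all add: e)
  then show "g\<^sub>0 = h\<^sub>0 \<and> g\<^sub>1 = h\<^sub>1 \<and> t = s" using bit_cases[of t] bit_cases[of s] by (auto simp: decomp_def fun_eq_iff)
qed auto

lemma node_mult:
  "node g\<^sub>0 g\<^sub>1 t * node h\<^sub>0 h\<^sub>1 s = node ((if s = 0 then g\<^sub>0 else g\<^sub>1) * h\<^sub>0) ((if s = 0 then g\<^sub>1 else g\<^sub>0) * h\<^sub>1) (s + t)"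
  by (auto simp: node_def times_tree_map_def decomp_comp)

lemma node_one [simp]: "node 1 1 0 = 1"
  by (simp add: node_def one_tree_map_def decomp_id)

lemma node_inject [simp]: "node g\<^sub>0 g\<^sub>1 t = node h\<^sub>0 h\<^sub>1 s \<longleftrightarrow> g\<^sub>0 = h\<^sub>0 \<and> g\<^sub>1 = h\<^sub>1 \<and> t = s"
  by (auto simp: node_def decomp_inject apply_map_inject)

lemma node_eq_one [simp]: "node g\<^sub>0 g\<^sub>1 t = 1 \<longleftrightarrow> g\<^sub>0 = 1 \<and> g\<^sub>1 = 1 \<and> t = 0"
  by (subst node_one[symmetric]) (simp only: node_inject)

text \<open>The automorphisms of the finite tree of depth \<open>m\<close>, extended trivially below
  it.\<close>

fun level_maps :: "nat \<Rightarrow> tree_map set" where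
  "level_maps 0 = {1}"
| "level_maps (Suc m) = {node g h t | g h t. g \<in> level_maps m \<and> h \<in> level_maps m}"

lemma finite_level_maps: "finite (level_maps m)"
proof (induction m)
  case (Suc m)
  have "level_maps (Suc m) = (\<lambda>(g, h, t). node g h t) ` (level_maps m \<times> level_maps m \<times> UNIV)"
    by (auto simp: image_iff)
  moreover have "finite (UNIV :: bit set)" by (simp only: UNIV_bit_eq finite_insert finite.emptyI)
  ultimately show ?case using Suc by simp
qed simp

lemma one_level_maps: "1 \<in> level_maps m"
proof (induction m)
  case (Suc m)
  then show ?case using node_one by (auto intro!: exI[of _ 1])
qed simp

lemma mult_level_maps: "g \<in> level_maps m \<Longrightarrow> h \<in> level_maps m \<Longrightarrow> g * h \<in> level_maps m"
proof (induction m arbitrary: g h)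
  case (Suc m)
  then show ?case by (auto simp: node_mult)
qed simp

definition flip :: "nat \<Rightarrow> bit \<Rightarrow> tree_map" where
  "flip m t = (if m = 0 then 1 else node 1 1 t)"

text \<open>
  \<open>ray m s\<close> is the truncation to level \<open>m\<close> of the element of \<open>B\<close> on which the \<open>k\<close>-th functional takes the
  value \<open>s k\<close>, and \<open>flip m 1\<close> is the truncation of \<open>a\<close>. A sequence over two functionals only produces
  the value sequences \<open>0\<close>, \<open>1\<close>, \<open>s\<close>, \<open>1 + s\<close>.
\<close>

fun ray :: "nat \<Rightarrow> (nat \<Rightarrow> bit) \<Rightarrow> tree_map" where
  "ray 0 s = 1"
| "ray (Suc m) s = node (flip m (s 0)) (ray m (shift s)) 0"

lemma flip_level_maps: "flip m t \<in> level_maps m"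
  by (cases m) (auto simp: flip_def one_level_maps)

lemma ray_level_maps: "ray m s \<in> level_maps m"
  by (induction m arbitrary: s) (auto simp: flip_level_maps)

lemma flip_zero [simp]: "flip m 0 = 1"
  by (simp add: flip_def)

lemma flip_mult: "flip m s * flip m t = flip m (s + t)"
  by (auto simp: flip_def node_mult add.commute)

lemma flip_square: "flip m t * flip m t = 1"
  by (simp add: flip_mult)

lemma ray_mult: "ray m s * ray m t = ray m (s + t)"
  by (induction m arbitrary: s t) (auto simp: node_mult flip_mult shift_def plus_fun_def)

lemma ray_zero [simp]: "ray m 0 = 1"
proof (induction m)
  case (Suc m)
  have "shift (\<lambda>_. 0) = (\<lambda>_. 0 :: bit)" by (simp add: shift_def)
  then show ?case using Suc by (simp add: zero_fun_def)
qed simp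

lemma fun_bit_add_self [simp]: "s + s = (0 :: nat \<Rightarrow> bit)"
  by (auto simp: fun_eq_iff)

lemma ray_square: "ray m s * ray m s = 1"
  by (simp add: ray_mult)

lemma shift_add_one: "shift (1 + s) = 1 + shift (s :: nat \<Rightarrow> bit)"
  by (simp add: shift_def fun_eq_iff)

lemma three_involutions_tree: "three_involutions (flip m 1) (ray m s) (ray m t)"
  by standard (simp_all add: flip_square ray_square)

text \<open>The sum of the root permutations of all sections at level \<open>j\<close>; the maps under \<open>tl\<close> are the two sections of \<open>g\<close>.\<close>

fun label_sum :: "nat \<Rightarrow> tree_map \<Rightarrow> bit" where
  "label_sum 0 g = hd (apply_map g [0])"
| "label_sum (Suc j) g = label_sum j (Map (\<lambda>w. tl (apply_map g (0 # w)))) + label_sum j (Map (\<lambda>w. tl (apply_map g (1 # w))))"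

declare label_sum.simps [simp del]

lemma label_sum_node [simp]:
  "label_sum 0 (node g h t) = t"
  "label_sum (Suc j) (node g h t) = label_sum j g + label_sum j h"
  by (simp_all add: label_sum.simps node_def decomp_def)

lemma label_sum_one [simp]: "label_sum j 1 = 0"
proof (induction j)
  case 0
  show ?case using label_sum_node(1)[of 1 1 0] by simp
next
  case (Suc j)
  then show ?case using label_sum_node(2)[of j 1 1 0] by simp
qed

text \<open>A product permutes the vertices of a level and adds the root permutations there, so the
  sum is a homomorphism to the two-element group.\<close>

lemma label_sum_mult:
  "g \<in> level_maps m \<Longrightarrow> h \<in> level_maps m \<Longrightarrow> label_sum j (g * h) = label_sum j g + label_sum j h"
proof (induction m arbitrary: g h j)
  case (Suc m)
  then obtain g0 g1 t h0 h1 s where e: "g = node g0 g1 t" "h = node h0 h1 s"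
    "g0 \<in> level_maps m" "g1 \<in> level_maps m" "h0 \<in> level_maps m" "h1 \<in> level_maps m" by auto
  show ?case
  proof (cases j)
    case 0
    then show ?thesis using e bit_cases[of t] bit_cases[of s] by (auto simp: node_mult)
  next
    case (Suc i)
    then show ?thesis using e Suc.IH bit_cases[of "label_sum i g0"] bit_cases[of "label_sum i g1"]
        bit_cases[of "label_sum i h0"] bit_cases[of "label_sum i h1"] by (auto simp: node_mult)
  qed
qed simp

lemma label_sum_flip: "j > 0 \<Longrightarrow> label_sum j (flip m t) = 0"
  by (cases j) (simp_all add: flip_def)

text \<open>On level \<open>j + 1\<close> only the vertex consisting of \<open>j\<close> ones and a
  zero can carry a nontrivial permutation, namely \<open>s j\<close>. The bound on \<open>m\<close>
  keeps this level above the truncation.\<close>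

lemma label_sum_ray: "m \<ge> j + 2 \<Longrightarrow> label_sum (Suc j) (ray m s) = s j"
proof (induction j arbitrary: m s)
  case 0
  then obtain k where "m = Suc (Suc k)" by (metis add_2_eq_Suc le_Suc_ex add.commute add_0)
  then show ?case by (simp add: flip_def)
next
  case (Suc j)
  then obtain k where k: "m = Suc k" "k \<ge> j + 2" by (cases m) auto
  then show ?case using Suc.IH[of k "shift s"] by (simp add: label_sum_flip shift_def)
qed

section \<open>Level quotients and their first-level stabilisers\<close>

abbreviation spinal_quot :: "nat \<Rightarrow> (nat \<Rightarrow> bit) \<Rightarrow> tree_map set" where
  "spinal_quot m s \<equiv> gen_group (flip m 1) (ray m s) (ray m (1 + s))"

lemma spinal_quot_complement: "spinal_quot m (1 + s) = spinal_quot m s"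
proof -
  have e: "1 + (1 + s) = s" by (simp add: fun_eq_iff)
  have "g \<in> gen_group a d c" if "g \<in> gen_group a c d" for g a c d :: tree_map
    using that by induction (auto intro: gen_group.intros)
  then show ?thesis unfolding e by blast
qed

lemma spinal_quot_subset: "spinal_quot m s \<subseteq> level_maps m"
proof
  fix g assume "g \<in> spinal_quot m s"
  then show "g \<in> level_maps m"
    by induction (auto intro: mult_level_maps flip_level_maps ray_level_maps one_level_maps)
qed

lemma finite_spinal_quot: "finite (spinal_quot m s)"
  by (rule finite_subset[OF spinal_quot_subset finite_level_maps])

text \<open>The root swap conjugates the other two generators into their mirror images. These four
  elements have the generators of the twin group as sections, and the root permutation is
  free.\<close>

lemma gen_group_node:
  "gen_group (node 1 1 1) (node 1 c 0) (node a d 0) = (\<lambda>((g, h), t). node g h t) ` (twin_group a c d \<times> UNIV)"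
    (is "?G = _ ` (?H \<times> _)")
proof -
  have 1: "\<exists>g h t. x = node g h t \<and> (g, h) \<in> ?H" if "x \<in> ?G" for x
    using that
  proof induction
    case gen_group_one
    show ?case by (intro exI[of _ 1] exI[of _ 0]) (simp add: twin_group.intros)
  next
    case (gen_group_step x g)
    then obtain g0 g1 t where g: "g = node g0 g1 t" "(g0, g1) \<in> ?H" by blast
    have H: "(g0, c * g1) \<in> ?H" "(c * g0, g1) \<in> ?H" "(a * g0, d * g1) \<in> ?H" "(d * g0, a * g1) \<in> ?H"
      using g twin_group.twin_group_step[of _ _ c a d g0 g1] by force+
    consider "x = node 1 1 1" | "x = node 1 c 0" | "x = node a d 0" using gen_group_step by blast
    then show ?case
      by cases (use g bit_cases[of t] H in \<open>auto simp: node_mult\<close>)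
  qed
  have G: "node 1 1 1 * z \<in> ?G" "node 1 c 0 * z \<in> ?G" "node a d 0 * z \<in> ?G" if "z \<in> ?G" for z
    using that gen_group.gen_group_step by blast+
  have 2: "node g h 0 \<in> ?G" if "(g, h) \<in> ?H" for g h
    using that
  proof induction
    case twin_group_one
    then show ?case by (simp add: gen_group.intros)
  next
    case (twin_group_step x y g h)
    consider "x = 1" "y = c" | "x = c" "y = 1" | "x = a" "y = d" | "x = d" "y = a"
      using twin_group_step by blast
    then show ?case
    proof cases
      case 1
      then show ?thesis using G(2)[OF twin_group_step.IH] by (simp add: node_mult)
    next
      case 2
      \<comment> \<open>Conjugation by the root swap interchanges the two sections.\<close>
      then show ?thesis using G(1)[OF G(2)[OF G(1)[OF twin_group_step.IH]]] by (simp add: node_mult)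
    next
      case 3
      then show ?thesis using G(3)[OF twin_group_step.IH] by (simp add: node_mult)
    next
      case 4
      then show ?thesis using G(1)[OF G(3)[OF G(1)[OF twin_group_step.IH]]] by (simp add: node_mult)
    qed
  qed
  have 3: "node g h t \<in> ?G" if "(g, h) \<in> ?H" for g h t
    using 2[OF that] G(1)[OF 2[OF that]] bit_cases[of t] by (auto simp: node_mult)
  show ?thesis
  proof (intro equalityI subsetI)
    fix x assume "x \<in> ?G"
    then obtain g h t where "x = node g h t" "(g, h) \<in> ?H" using 1 by blast
    then have "x = (\<lambda>((g, h), t). node g h t) ((g, h), t)" "((g, h), t) \<in> ?H \<times> UNIV" by simp_all
    then show "x \<in> (\<lambda>((g, h), t). node g h t) ` (?H \<times> UNIV)" by (rule image_eqI)
  next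
    fix x assume "x \<in> (\<lambda>((g, h), t). node g h t) ` (?H \<times> UNIV)"
    then show "x \<in> ?G" using 3 by auto
  qed
qed

lemma card_spinal_quot_Suc_twin:
  assumes "s 0 = 0"
  shows "card (spinal_quot (Suc m) s) = 2 * card (twin_group (flip m 1) (ray m (shift s)) (ray m (1 + shift s)))"
proof -
  have gens: "flip (Suc m) 1 = node 1 1 1" "ray (Suc m) s = node 1 (ray m (shift s)) 0"
    "ray (Suc m) (1 + s) = node (flip m 1) (ray m (1 + shift s)) 0"
    using assms by (simp_all add: flip_def shift_add_one del: add_bit_eq_xor)
  have "card (UNIV :: bit set) = 2"
    by (subst UNIV_bit_eq) simp
  moreover have "inj_on (\<lambda>((g, h), t). node g h t) X" for X
    by (auto simp: inj_on_def)
  ultimately show ?thesis unfolding gens gen_group_node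
    by (simp add: card_image card_cartesian_product)
qed

section \<open>Orders of the dihedral quotients\<close>

text \<open>Confines the sections of the normal closure to a set \<open>N\<close>. It is applied
  with \<open>N\<close> given by vanishing label sums, and with \<open>N\<close> the normal closure
  one level below.\<close>

lemma normal_closure_node:
  assumes c: "c = node c\<^sub>0 c\<^sub>1 0" "c\<^sub>0 \<in> N" "c\<^sub>1 \<in> N"
    and one: "1 \<in> N" and mult: "\<And>x y. x \<in> N \<Longrightarrow> y \<in> N \<Longrightarrow> x * y \<in> N"
    and conj: "\<And>x g g'. x \<in> N \<Longrightarrow> g \<in> S \<Longrightarrow> g' \<in> S \<Longrightarrow> g * g' = 1 \<Longrightarrow> g * x * g' \<in> N"
    and sections: "\<And>g. g \<in> gen_group a c d \<Longrightarrow> \<exists>g\<^sub>0\<in>S. \<exists>g\<^sub>1\<in>S. \<exists>t. g = node g\<^sub>0 g\<^sub>1 t"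
    and x: "x \<in> normal_closure a c d"
  shows "\<exists>x\<^sub>0\<in>N. \<exists>x\<^sub>1\<in>N. x = node x\<^sub>0 x\<^sub>1 0"
  using x
proof induction
  case normal_closure_one
  then show ?case using one node_one by metis
next
  case (normal_closure_step g g' l)
  then obtain x0 x1 where l: "l = node x0 x1 0" "x0 \<in> N" "x1 \<in> N" by blast
  obtain g0 g1 t where g: "g = node g0 g1 t" "g0 \<in> S" "g1 \<in> S"
    using sections normal_closure_step by blast
  obtain h0 h1 s where h: "g' = node h0 h1 s" "h0 \<in> S" "h1 \<in> S"
    using sections normal_closure_step by blast
  have inv: "(if s = 0 then g0 else g1) * h0 = 1" "(if s = 0 then g1 else g0) * h1 = 1" "s + t = 0"
    using normal_closure_step g h by (auto simp: node_mult simp del: add_bit_eq_xor)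
  then have "t = s" using bit_cases[of t] bit_cases[of s] by auto
  then have "g * c * g' * l = node ((if s = 0 then g0 * c\<^sub>0 else g1 * c\<^sub>1) * h0 * x0) ((if s = 0 then g1 * c\<^sub>1 else g0 * c\<^sub>0) * h1 * x1) 0"
    using g h l c bit_cases[of s] by (auto simp: node_mult)
  moreover have "(if s = 0 then g0 * c\<^sub>0 else g1 * c\<^sub>1) * h0 \<in> N" "(if s = 0 then g1 * c\<^sub>1 else g0 * c\<^sub>0) * h1 \<in> N"
    using inv conj c g h by (auto split: if_splits)
  ultimately show ?case using mult l by blast
qed

text \<open>
  The normal closure of \<open>c\<close> acts below the first level with trivial label sums at level \<open>r\<close> on either side,
  whereas \<open>d\<close> has label sum \<open>1\<close>: this separates the dihedral words from the normal closure.
\<close>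

lemma dihedral_base:
  assumes r: "r \<ge> 1" "\<And>i. i < r \<Longrightarrow> s i = 1" "s r = 0" and m: "m \<ge> r + 2"
  shows "dihedral_involutions (flip m 1) (ray m s) (ray m (1 + s)) 8"
proof -
  obtain l where l: "m = Suc l" "l \<ge> (r - 1) + 2" using m r by (cases m) auto
  define e where "e = ray l (1 + shift s)"
  have ee: "e * e = 1" unfolding e_def by (rule ray_square)
  have gens: "flip m 1 = node 1 1 1" "ray m s = node (flip l 1) (ray l (shift s)) 0" "ray m (1 + s) = node 1 e 0"
    using r(2)[of 0] r(1) unfolding l(1) e_def by (simp_all add: flip_def shift_add_one)
  have sum: "label_sum r (ray l v) = v (r - 1)" for v
    using label_sum_ray[OF l(2)] r(1) by simp
  have sum_e: "label_sum r e = 1" unfolding e_def sum using r by (simp add: shift_def)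
  interpret three_involutions "node 1 1 1" "node (flip l 1) (ray l (shift s)) 0" "node 1 e 0"
    using three_involutions_tree[of m s "1 + s"] unfolding gens .
  have w8: "word 8 = 1"
    by (simp add: numeral_eq_Suc node_mult ee)
  \<comment> \<open>Every nonempty word of length below \<open>8\<close> either swaps the root or
    has a section \<open>e\<close>, whose label sum is \<open>1\<close>.\<close>
  have words: "word 1 = node 1 1 1" "word 2 = node 1 e 1" "word 3 = node e 1 0" "word 4 = node e e 0"
    "word 5 = node e e 1" "word 6 = node e 1 1" "word 7 = node 1 e 0"
    by (simp_all add: numeral_eq_Suc node_mult ee)
  have sub: "\<exists>x0 x1. x = node x0 x1 0 \<and> label_sum r x0 = 0 \<and> label_sum r x1 = 0" if "x \<in> Nc" for x
  proof -
    have "\<exists>x\<^sub>0\<in>{x \<in> level_maps l. label_sum r x = 0}. \<exists>x\<^sub>1\<in>{x \<in> level_maps l. label_sum r x = 0}. x = node x\<^sub>0 x\<^sub>1 0"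
    proof (rule normal_closure_node[OF refl _ _ _ _ _ _ that, where S = "level_maps l"])
      show "flip l 1 \<in> {x \<in> level_maps l. label_sum r x = 0}"
        using r(1) by (simp add: flip_level_maps label_sum_flip)
      show "ray l (shift s) \<in> {x \<in> level_maps l. label_sum r x = 0}"
        using r by (simp add: ray_level_maps sum shift_def)
      show "1 \<in> {x \<in> level_maps l. label_sum r x = 0}" by (simp add: one_level_maps)
      show "x * y \<in> {x \<in> level_maps l. label_sum r x = 0}"
        if "x \<in> {x \<in> level_maps l. label_sum r x = 0}" "y \<in> {x \<in> level_maps l. label_sum r x = 0}" for x y
        using that mult_level_maps[of x l y] label_sum_mult[of x l y r] by simp
      show "g * x * g' \<in> {x \<in> level_maps l. label_sum r x = 0}"
        if x: "x \<in> {x \<in> level_maps l. label_sum r x = 0}" and g: "g \<in> level_maps l" "g' \<in> level_maps l" and "g * g' = 1" for x g g'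
      proof -
        have "label_sum r g + label_sum r g' = 0"
          using label_sum_mult[OF g, of r] that(4) by (simp del: add_bit_eq_xor)
        moreover have "label_sum r (g * x * g') = label_sum r g + label_sum r x + label_sum r g'"
          using x g mult_level_maps[of g l x] label_sum_mult[of g l x r] label_sum_mult[of "g * x" l g' r]
          by (simp del: add_bit_eq_xor)
        ultimately show ?thesis using x g mult_level_maps[of g l x] mult_level_maps[of "g * x" l g']
          by (simp del: add_bit_eq_xor)
      qed
      show "\<exists>g\<^sub>0\<in>level_maps l. \<exists>g\<^sub>1\<in>level_maps l. \<exists>t. g = node g\<^sub>0 g\<^sub>1 t" if "g \<in> Gr" for g
      proof -
        have "g \<in> level_maps (Suc l)" using that spinal_quot_subset[of m s] unfolding gens unfolding l(1) by blast
        then show ?thesis by auto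
      qed
    qed
    then show ?thesis by blast
  qed
  have "8 dvd n" if n: "word n \<in> Nc" for n
  proof -
    have "word n = word (n mod 8)" using w8 by (rule alternating_mod) simp
    then obtain x0 x1 where x: "word (n mod 8) = node x0 x1 0" "label_sum r x0 = 0" "label_sum r x1 = 0"
      using sub[OF n] by auto
    have "n mod 8 < 8" by simp
    then consider "n mod 8 = 0" | "n mod 8 = 1" | "n mod 8 = 2" | "n mod 8 = 3" | "n mod 8 = 4"
      | "n mod 8 = 5" | "n mod 8 = 6" | "n mod 8 = 7" by linarith
    then show ?thesis
      by cases (use x sum_e in \<open>auto simp: words\<close>)
  qed
  then show ?thesis unfolding gens using w8 by unfold_locales simp_all
qed

text \<open>The sections of \<open>word 4\<close> are the words of length \<open>2\<close> one level
  below. Hence the rotation \<open>a * d\<close> takes twice as many steps to become trivial, and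
  the order doubles.\<close>

lemma dihedral_step:
  assumes s: "s 0 = 0" and p: "dihedral_involutions (flip m 1) (ray m (shift s)) (ray m (1 + shift s)) p"
  shows "dihedral_involutions (flip (Suc m) 1) (ray (Suc m) s) (ray (Suc m) (1 + s)) (2 * p)"
proof -
  define a c d where acd: "a = flip m 1" "c = ray m (shift s)" "d = ray m (1 + shift s)"
  interpret D: dihedral_involutions a c d p using p unfolding acd .
  have gens: "flip (Suc m) 1 = node 1 1 1" "ray (Suc m) s = node 1 c 0" "ray (Suc m) (1 + s) = node a d 0"
    using s by (simp_all add: flip_def shift_add_one acd del: add_bit_eq_xor)
  interpret three_involutions "node 1 1 1" "node 1 c 0" "node a d 0"
    using three_involutions_tree[of "Suc m" s "1 + s"] unfolding gens .
  have w4: "word (4 * q) = node (D.coword (2 * q)) (D.word (2 * q)) 0" for q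
  proof (induction q)
    case (Suc q)
    have "word (4 * Suc q) = word 4 * word (4 * q)" using alternating_add[of 4 "4 * q" "node 1 1 1" "node a d 0"] by simp
    also have "word 4 = node (D.coword 2) (D.word 2) 0"
      by (simp add: numeral_eq_Suc node_mult)
    also have "node (D.coword 2) (D.word 2) 0 * word (4 * q) = node (D.coword 2 * D.coword (2 * q)) (D.word 2 * D.word (2 * q)) 0"
      unfolding Suc by (simp add: node_mult)
    also have "\<dots> = node (D.coword (2 * Suc q)) (D.word (2 * Suc q)) 0"
      using alternating_add[of 2 "2 * q" a d] alternating_add[of 2 "2 * q" d a] by simp
    finally show ?case .
  qed simp
  have sub: "\<exists>x\<^sub>0\<in>D.Nc. \<exists>x\<^sub>1\<in>D.Nc. x = node x\<^sub>0 x\<^sub>1 0" if "x \<in> Nc" for x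
  proof (rule normal_closure_node[OF refl _ _ _ _ _ _ that, where S = D.Gr])
    show "1 \<in> D.Nc" "1 \<in> D.Nc" by (rule normal_closure.intros)+
    show "c \<in> D.Nc" by (rule D.Nc_c)
    show "x * y \<in> D.Nc" if "x \<in> D.Nc" "y \<in> D.Nc" for x y using that by (rule D.Nc_comp)
    show "g * x * g' \<in> D.Nc" if x: "x \<in> D.Nc" "g \<in> D.Gr" "g' \<in> D.Gr" "g * g' = 1" for x g g'
    proof -
      obtain h where h: "g * h = 1" "h * g = 1" using D.Gr_inverse x by blast
      then have "h = g'" using inverse_unique_monoid x by blast
      then show ?thesis using D.Nc_conj x h by blast
    qed
    show "\<exists>g\<^sub>0\<in>D.Gr. \<exists>g\<^sub>1\<in>D.Gr. \<exists>t. g = node g\<^sub>0 g\<^sub>1 t" if "g \<in> Gr" for g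
      using that D.Tw_subset unfolding gen_group_node by auto
  qed
  obtain q0 where q0: "p = 2 * q0" using D.p by auto
  have "word (2 * p) = 1"
    using w4[of q0] D.word_p D.coword_p q0 by simp
  moreover have "2 * p dvd n" if n: "word n \<in> Nc" for n
  proof -
    obtain q r where qr: "n = 4 * q + r" "r < 4" using div_mult_mod_eq[of n 4] by (metis mod_less_divisor mult.commute zero_less_numeral)
    have w: "word n = word (4 * q) * word r"
      unfolding qr using alternating_add[of "4 * q" r "node 1 1 1" "node a d 0"] by simp
    obtain x0 x1 where x: "word n = node x0 x1 0" "x1 \<in> D.Nc" using sub[OF n] by blast
    \<comment> \<open>Remainders \<open>1\<close> and \<open>2\<close> swap the root. Remainder
      \<open>3\<close> would put a word of odd length into the lower normal closure, against the
      evenness of \<open>p\<close>.\<close>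
    consider "r = 0" | "r = 1" | "r = 2" | "r = 3" using qr by linarith
    then show ?thesis
    proof cases
      case 1
      then have "D.word (2 * q) \<in> D.Nc" using w x w4 by simp
      then have "p dvd 2 * q" by (rule D.word_Nc)
      then have "2 * p dvd 2 * (2 * q)" by (rule mult_dvd_mono[OF dvd_refl])
      then show ?thesis using qr 1 by simp
    next
      case 2
      then show ?thesis using w x w4 by (simp add: node_mult)
    next
      case 3
      then show ?thesis using w x w4 by (simp add: numeral_eq_Suc node_mult)
    next
      case 4
      have "word 3 = node d a 0" by (simp add: numeral_eq_Suc node_mult)
      then have "x1 = D.word (2 * q) * a" using w x w4 4 by (simp add: node_mult)
      also have "\<dots> = D.word (2 * q + 1)" using alternating_add[of "2 * q" 1 a d] by simp
      finally have "p dvd 2 * q + 1" using x D.word_Nc by metis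
      then have "2 dvd 2 * q + 1" using D.p(2) dvd_trans by blast
      then show ?thesis by simp
    qed
  qed
  ultimately show ?thesis unfolding gens using D.p by unfold_locales simp_all
qed

text \<open>Order \<open>8\<close> at the run of ones, doubled once for each of the \<open>k\<close>
  zeros in front of it.\<close>

lemma dihedral_tree:
  assumes "r \<ge> 1" "\<And>i. i < k \<Longrightarrow> s i = 0" "\<And>i. k \<le> i \<Longrightarrow> i < k + r \<Longrightarrow> s i = 1" "s (k + r) = 0" "m \<ge> k + r + 2"
  shows "dihedral_involutions (flip m 1) (ray m s) (ray m (1 + s)) (2 ^ (k + 3))"
  using assms
proof (induction k arbitrary: s m)
  case 0
  have e: "(2 :: nat) ^ (0 + 3) = 8" by simp
  show ?case unfolding e by (rule dihedral_base[of r]) (use 0 in simp_all)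
next
  case (Suc k)
  obtain l where l: "m = Suc l" using Suc.prems by (cases m) auto
  have "dihedral_involutions (flip l 1) (ray l (shift s)) (ray l (1 + shift s)) (2 ^ (k + 3))"
    using Suc.prems by (intro Suc.IH) (auto simp: shift_def l)
  then have "dihedral_involutions (flip m 1) (ray m s) (ray m (1 + s)) (2 * 2 ^ (k + 3))"
    unfolding l using Suc.prems(2)[of 0] by (intro dihedral_step) simp_all
  then show ?case by (simp only: add_Suc power_Suc)
qed

section \<open>Recursion for the logarithm of the order\<close>

text \<open>The twins have index \<open>2 ^ (k + 3)\<close> among all pairs, and the free root
  permutation gives back one factor \<open>2\<close>.\<close>

lemma card_spinal_quot_Suc:
  assumes "s 0 = 0" "r \<ge> 1" "\<And>i. i < k \<Longrightarrow> s (Suc i) = 0" "\<And>i. k \<le> i \<Longrightarrow> i < k + r \<Longrightarrow> s (Suc i) = 1"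
    "s (Suc (k + r)) = 0" "m \<ge> k + r + 2"
  shows "card (spinal_quot (Suc m) s) * 2 ^ (k + 2) = (card (spinal_quot m (shift s)))\<^sup>2"
proof -
  interpret dihedral_involutions "flip m 1" "ray m (shift s)" "ray m (1 + shift s)" "2 ^ (k + 3)"
    using assms by (intro dihedral_tree[of r]) (auto simp: shift_def)
  have "card (spinal_quot (Suc m) s) * 2 ^ (k + 2) = card Tw * 2 ^ (k + 3)"
    unfolding card_spinal_quot_Suc_twin[of s m, OF assms(1)] by (simp add: power_add)
  then show ?thesis using card_twin_group by (simp add: power2_eq_square)
qed

definition level_log :: "nat \<Rightarrow> (nat \<Rightarrow> bit) \<Rightarrow> real" where
  "level_log m s = log 2 (card (spinal_quot m s))"

lemma card_spinal_quot_pos: "card (spinal_quot m s) > 0"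
proof -
  have "1 \<in> spinal_quot m s" by (rule gen_group.gen_group_one)
  then have "spinal_quot m s \<noteq> {}" by (rule ex_in_conv[THEN iffD1, OF exI])
  then show ?thesis using finite_spinal_quot card_gt_0_iff by blast
qed

lemma level_log_complement: "level_log m (1 + s) = level_log m s"
proof -
  have "spinal_quot m (1 + s) = spinal_quot m s" by (rule spinal_quot_complement)
  then have "log 2 (real (card (spinal_quot m (1 + s)))) = log 2 (real (card (spinal_quot m s)))" by (rule arg_cong)
  then show ?thesis unfolding level_log_def .
qed

lemma level_log_Suc_run:
  assumes "s 0 = 0" "r \<ge> 1" "\<And>i. i < k \<Longrightarrow> s (Suc i) = 0" "\<And>i. k \<le> i \<Longrightarrow> i < k + r \<Longrightarrow> s (Suc i) = 1"
    "s (Suc (k + r)) = 0" "m \<ge> k + r + 2"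
  shows "level_log (Suc m) s = 2 * level_log m (shift s) - (k + 2)"
proof -
  define A B where "A = real (card (spinal_quot (Suc m) s))" and "B = real (card (spinal_quot m (shift s)))"
  have pos: "A > 0" "B > 0"
    unfolding A_def B_def of_nat_0_less_iff by (rule card_spinal_quot_pos)+
  have "A * 2 ^ (k + 2) = B ^ 2"
    using arg_cong[OF card_spinal_quot_Suc[OF assms], of real] unfolding A_def B_def
    by (simp only: of_nat_mult of_nat_numeral of_nat_power)
  moreover have "log 2 (A * 2 ^ (k + 2)) = log 2 A + real (k + 2)"
    using pos log_pow_cancel[of 2 "k + 2"] by (simp add: log_mult del: power_add_numeral2 power_Suc)
  moreover have "log 2 (B ^ 2) = 2 * log 2 B"
    using pos by (simp add: log_nat_power)
  ultimately show ?thesis unfolding level_log_def A_def[symmetric] B_def[symmetric] by simp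
qed

definition repeats :: "(nat \<Rightarrow> bit) \<Rightarrow> nat set" where
  "repeats s = {i. s i = s (Suc i)}"

lemma repeats_complement: "repeats (1 + s) = repeats s"
proof -
  have "1 + x = 1 + y \<longleftrightarrow> x = y" for x y :: bit using bit_cases[of x] bit_cases[of y] by auto
  then show ?thesis by (simp add: repeats_def)
qed

text \<open>Up to complement, the sequence starts with \<open>0010\<close>, \<open>0110\<close> or
  \<open>010\<close>. After the first letter there is a leading zero only in the first case, so
  \<open>k\<close> is \<open>1\<close> exactly at a repetition. The longest run needs
  \<open>m \<ge> 4\<close>.\<close>

lemma level_log_Suc:
  assumes m: "m \<ge> 4" and sparse: "0 \<in> repeats s \<Longrightarrow> 1 \<notin> repeats s" "0 \<in> repeats s \<or> 1 \<in> repeats s \<Longrightarrow> 2 \<notin> repeats s"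
  shows "level_log (Suc m) s = 2 * level_log m (shift s) - (2 + of_bool (0 \<in> repeats s))"
proof -
  have zero: "level_log (Suc m) s = 2 * level_log m (shift s) - (2 + of_bool (0 \<in> repeats s))"
    if s: "s 0 = 0" "0 \<in> repeats s \<Longrightarrow> 1 \<notin> repeats s" "0 \<in> repeats s \<or> 1 \<in> repeats s \<Longrightarrow> 2 \<notin> repeats s" for s
  proof -
    have two: "Suc (Suc 0) = 2" "Suc 2 = 3" by simp_all
    have S: "i \<in> repeats s \<longleftrightarrow> s (Suc i) = s i" for i by (auto simp: repeats_def)
    have N: "i \<notin> repeats s \<longleftrightarrow> s (Suc i) = 1 + s i" for i
      using bit_cases[of "s i"] bit_cases[of "s (Suc i)"] by (auto simp: repeats_def)
    consider "0 \<in> repeats s" | "0 \<notin> repeats s" "1 \<in> repeats s" | "0 \<notin> repeats s" "1 \<notin> repeats s" by blast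
    then show ?thesis
    proof cases
      case 1
      then have "s 1 = 0" "s 2 = 1" "s 3 = 0" using s S[of 0] N[of 1] N[of 2] by (auto simp: two)
      then show ?thesis
        using level_log_Suc_run[of s 1 1 m] s(1) m 1 by (simp add: less_Suc_eq le_less numeral_eq_Suc)
    next
      case 2
      then have "s 1 = 1" "s 2 = 1" "s 3 = 0" using s N[of 0] S[of 1] N[of 2] by (auto simp: two)
      then have "s (Suc i) = 1" if "i < 2" for i using that by (auto simp: less_Suc_eq numeral_eq_Suc)
      then show ?thesis
        using level_log_Suc_run[of s 2 0 m] \<open>s 3 = 0\<close> s(1) m 2 by (simp add: numeral_3_eq_3)
    next
      case 3
      then have "s 1 = 1" "s 2 = 0" using s N[of 0] N[of 1] by (auto simp: two)
      then show ?thesis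
        using level_log_Suc_run[of s 1 0 m] s(1) m 3 by (simp add: less_Suc_eq numeral_eq_Suc)
    qed
  qed
  show ?thesis
  proof (cases "s 0 = 0")
    case True
    then show ?thesis using zero sparse by blast
  next
    case False
    then have "(1 + s) 0 = 0" using bit_cases[of "s 0"] by simp
    then have "level_log (Suc m) (1 + s) = 2 * level_log m (shift (1 + s)) - (2 + of_bool (0 \<in> repeats (1 + s)))"
      using sparse zero[of "1 + s"] unfolding repeats_complement by blast
    then show ?thesis unfolding repeats_complement shift_add_one level_log_complement .
  qed
qed

section \<open>Prescribing the lower limit\<close>

definition past_weight :: "nat set \<Rightarrow> nat \<Rightarrow> real" where
  "past_weight R m = (\<Sum>i<m. of_bool (i \<in> R) / 2 ^ (m - i))"

lemma past_weight_0 [simp]: "past_weight R 0 = 0"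
  by (simp add: past_weight_def)

lemma past_weight_Suc: "past_weight R (Suc m) = (past_weight R m + of_bool (m \<in> R)) / 2"
proof -
  have "(\<Sum>i<m. of_bool (i \<in> R) / 2 ^ (Suc m - i)) = (\<Sum>i<m. of_bool (i \<in> R) / 2 ^ (m - i) / (2 :: real))"
    by (intro sum.cong) (auto simp: Suc_diff_le)
  then show ?thesis by (simp add: past_weight_def sum_divide_distrib add_divide_distrib)
qed

text \<open>Matches the removal of the first letter of a sequence, whereas
  \<open>past_weight_Suc\<close> advances the time.\<close>

lemma past_weight_Suc_front:
  "past_weight R (Suc m) = of_bool (0 \<in> R) / 2 ^ Suc m + past_weight {i. Suc i \<in> R} m"
  by (simp add: past_weight_def sum.lessThan_Suc_shift del: sum.lessThan_Suc)

lemma past_weight_bounds: "0 \<le> past_weight R m" "past_weight R m \<le> 1"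
  by (induction m) (auto simp: past_weight_Suc)

text \<open>The last \<open>k\<close> positions supply the leading binary digits; everything older
  is damped by \<open>2 ^ k\<close>.\<close>

lemma past_weight_add:
  "past_weight R (m + k) = past_weight R m / 2 ^ k + (\<Sum>j<k. of_bool (m + k - Suc j \<in> R) / 2 ^ Suc j)"
proof (induction k)
  case (Suc k)
  have "(\<Sum>j<Suc k. of_bool (m + Suc k - Suc j \<in> R) / 2 ^ Suc j) =
    of_bool (m + k \<in> R) / 2 + (\<Sum>j<k. of_bool (m + k - Suc j \<in> R) / (2 :: real) ^ Suc j) / 2"
    by (simp add: sum.lessThan_Suc_shift sum_divide_distrib del: sum.lessThan_Suc)
  then show ?case using Suc by (simp add: past_weight_Suc add_divide_distrib)
qed simp

definition sparse :: "nat set \<Rightarrow> bool" where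
  "sparse R \<longleftrightarrow> (\<forall>i\<in>R. Suc i \<notin> R \<and> Suc (Suc i) \<notin> R)"

text \<open>
  The value is a minimum over the positions of the time \<open>m\<close> relative to the nearest element of \<open>R\<close>;
  all three expressions decrease strictly with \<open>V\<close>.
\<close>

lemma liminf_past_weight:
  fixes F :: "bool \<Rightarrow> bool \<Rightarrow> real"
  assumes sparse: "sparse R" and p: "strict_mono p" "\<And>n. p n \<in> R" "(\<lambda>n. past_weight R (p n)) \<longlonglongrightarrow> V"
    and upper: "\<And>e. e > 0 \<Longrightarrow> \<forall>\<^sub>F m in sequentially. m \<in> R \<longrightarrow> past_weight R m \<le> V + e"
    and d: "d \<longlonglongrightarrow> 0"
  shows "liminf (\<lambda>m. ereal (F (m \<in> R) (Suc m \<in> R) - past_weight R m / 16 + d m)) =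
    ereal (min (F True False - V / 16) (min (F False True - V / 8) (F False False - (1 + V) / 32)))"
    (is "liminf (\<lambda>m. ereal (?y m)) = ereal ?L")
proof (rule antisym)
  let ?t = "past_weight R"
  have sub: "liminf (\<lambda>m. ereal (?y m)) \<le> ereal c" if "strict_mono q" "(\<lambda>n. ?y (q n)) \<longlonglongrightarrow> c" for q c
  proof -
    have "liminf (\<lambda>m. ereal (?y m)) \<le> liminf ((\<lambda>m. ereal (?y m)) \<circ> q)" by (rule liminf_subseq_mono[OF that(1)])
    also have "\<dots> = ereal c" using that(2) by (intro lim_imp_Liminf) (auto simp: o_def)
    finally show ?thesis .
  qed
  have dq: "(\<lambda>n. d (q n)) \<longlonglongrightarrow> 0" if "strict_mono q" for q
    using LIMSEQ_subseq_LIMSEQ[OF d that] by (simp add: o_def)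
  \<comment> \<open>The index \<open>Suc n\<close> makes the site positive, so that it has a
    predecessor \<open>q n\<close>.\<close>
  have pos: "p (Suc n) = Suc (p (Suc n) - 1)" for n
    using strict_monoD[OF p(1), of 0 "Suc n"] by simp
  define q where "q n = p (Suc n) - 1" for n
  have pq: "p (Suc n) = Suc (q n)" for n using pos q_def by simp
  have q: "strict_mono q"
    using strict_monoD[OF p(1)] pq by (intro strict_monoI) (metis Suc_less_eq)
  have sp: "Suc i \<notin> R" "Suc (Suc i) \<notin> R" if "i \<in> R" for i using sparse that by (auto simp: sparse_def)
  have qR: "q n \<notin> R" "Suc (q n) \<in> R" for n using p(2)[of "Suc n"] sp[of "q n"] pq[of n] by auto
  \<comment> \<open>Just before a site the weight is twice the weight at the site, which gives the
    term with \<open>V / 8\<close>.\<close>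
  have tq: "?t (q n) = 2 * ?t (p (Suc n))" for n
    unfolding pq past_weight_Suc using qR by simp
  have lim_Suc: "(\<lambda>n. ?t (p (Suc n))) \<longlonglongrightarrow> V" using p(3) by (rule LIMSEQ_Suc)
  have "(\<lambda>n. F True False - ?t (p n) / 16 + d (p n)) \<longlonglongrightarrow> F True False - V / 16 + 0"
    by (intro tendsto_intros dq[OF p(1)] p(3)) simp
  then have 1: "(\<lambda>n. ?y (p n)) \<longlonglongrightarrow> F True False - V / 16 + 0"
    using p(2) sp[OF p(2)] by simp
  have "(\<lambda>n. F False True - 2 * ?t (p (Suc n)) / 16 + d (q n)) \<longlonglongrightarrow> F False True - (2 * V) / 16 + 0"
    by (intro tendsto_intros dq[OF q] lim_Suc) simp
  then have 2: "(\<lambda>n. ?y (q n)) \<longlonglongrightarrow> F False True - (2 * V) / 16 + 0"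
    using qR unfolding tq[symmetric] by simp
  \<comment> \<open>Just after a site the weight tends to \<open>(1 + V) / 2\<close>, which gives
    the third term.\<close>
  have "(\<lambda>n. F False False - ((?t (p n) + 1) / 2) / 16 + d (Suc (p n))) \<longlonglongrightarrow> F False False - ((V + 1) / 2) / 16 + 0"
    using dq[of "\<lambda>n. Suc (p n)"] p(1) by (intro tendsto_intros p(3)) (auto simp: strict_mono_def)
  then have 3: "(\<lambda>n. ?y (Suc (p n))) \<longlonglongrightarrow> F False False - ((V + 1) / 2) / 16 + 0"
    using p(2) sp[OF p(2)] by (simp add: past_weight_Suc)
  have m3: "strict_mono (\<lambda>n. Suc (p n))" using p(1) by (auto simp: strict_mono_def)
  have "liminf (\<lambda>m. ereal (?y m)) \<le> ereal (F True False - V / 16)" using sub[OF p(1) 1] by simp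
  moreover have "liminf (\<lambda>m. ereal (?y m)) \<le> ereal (F False True - V / 8)" using sub[OF q 2] by simp
  moreover have "liminf (\<lambda>m. ereal (?y m)) \<le> ereal (F False False - (1 + V) / 32)"
    using sub[OF m3 3] by (simp add: add.commute)
  ultimately show "liminf (\<lambda>m. ereal (?y m)) \<le> ereal ?L"
    by (simp add: min_def)
  show "ereal ?L \<le> liminf (\<lambda>m. ereal (?y m))"
  proof (rule le_Liminf_iff[THEN iffD2], intro allI impI)
    fix z assume z: "z < ereal ?L"
    obtain z' where z': "z < ereal z'" "z' < ?L"
      using ereal_dense2[OF z] by (auto simp: less_ereal.simps)
    \<comment> \<open>One half of the slack pays for the error in the weight, the other half for
      \<open>d\<close>.\<close>
    define e where "e = (?L - z') / 2"
    have e: "e > 0" using z' by (simp add: e_def)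
    obtain N where N: "\<And>m. m \<ge> N \<Longrightarrow> m \<in> R \<Longrightarrow> ?t m \<le> V + e"
      using upper[OF e] by (auto simp: eventually_sequentially)
    obtain N' where N': "\<And>m. m \<ge> N' \<Longrightarrow> \<bar>d m\<bar> < e"
      using d e by (auto simp: LIMSEQ_iff)
    have p0: "p N \<ge> N" using p(1) by (rule strict_mono_imp_increasing)
    \<comment> \<open>Directly after a site the bound comes from \<open>V + e\<close>; after a
      non-site the weight has been halved, which preserves it. The induction starts at a site, where
      the claim is vacuous.\<close>
    have T: "m \<notin> R \<longrightarrow> ?t m \<le> (1 + V + e) / 2" if "m \<ge> p N" for m
      using that
    proof (induction m rule: dec_induct)
      case base
      then show ?case using p(2) by simp
    next
      case (step m)
      have "?t m \<le> V + e" if "m \<in> R" using N[OF _ that] step(1) p0 by simp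
      then show ?case using step past_weight_bounds(1)[of R m] by (auto simp: past_weight_Suc)
    qed
    have "z < ereal (?y m)" if m: "m \<ge> max N' (p N)" for m
    proof -
      have "?y m > ?L - 2 * e"
      proof -
        consider "m \<in> R" | "m \<notin> R" "Suc m \<in> R" | "m \<notin> R" "Suc m \<notin> R" by blast
        then have "F (m \<in> R) (Suc m \<in> R) - ?t m / 16 \<ge> ?L - e"
        proof cases
          case 1
          then have "?t m \<le> V + e" using N[of m] m p0 by simp
          then show ?thesis using 1 sp[OF 1] e by (auto simp: min_def)
        next
          case 2
          then have "?t (Suc m) \<le> V + e" using N[of "Suc m"] m p0 by simp
          then have "?t m \<le> 2 * (V + e)" using 2 by (simp add: past_weight_Suc)
          then show ?thesis using 2 e by (auto simp: min_def)
        next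
          case 3
          then have "?t m \<le> (1 + V + e) / 2" using T m by simp
          moreover have "?L \<le> F False False - (1 + V) / 32" by simp
          ultimately show ?thesis using 3 e by simp argo
        qed
        then show ?thesis using N'[of m] m by simp
      qed
      also have "?L - 2 * e = z'" by (simp add: e_def field_simps)
      finally show ?thesis using z'(1) by (metis less_trans ereal_less(1) less_ereal.simps(1))
    qed
    then show "\<forall>\<^sub>F m in sequentially. z < ereal (?y m)"
      unfolding eventually_sequentially by blast
  qed
qed

section \<open>Sites below the squares and the numbers they code\<close>

text \<open>\<open>0\<close> marks the square itself and \<open>3\<close> secures the weight
  \<open>1 / 8\<close>. The set \<open>A\<close> is coded from \<open>7\<close> on in steps of
  \<open>4\<close>, so no gap there is below \<open>4\<close>.\<close>

definition pattern :: "nat set \<Rightarrow> nat set" where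
  "pattern A = insert 0 (insert 3 ((\<lambda>s. 4 * s + 7) ` A))"

text \<open>
  Every square is preceded by a reversed copy of an initial piece of the pattern. The gap \<open>3\<close> occurs only
  just below a square, so the past weight at any other site is at most \<open>1 / 8\<close>, and the upper limit is reached
  along the squares.
\<close>

definition sites :: "nat set \<Rightarrow> nat set" where
  "sites A = {p. \<exists>n x. n \<ge> 5 \<and> x \<le> n \<and> x \<in> pattern A \<and> p + x = n\<^sup>2}"

definition pattern_value :: "nat set \<Rightarrow> real" where
  "pattern_value A = (\<Sum>j. of_bool (Suc j \<in> pattern A) / 2 ^ Suc j)"

text \<open>Consecutive squares differ by \<open>2 * n - 1\<close>, while the block below
  \<open>n\<^sup>2\<close> reaches down by at most \<open>n\<close>.\<close>

lemma square_gap: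
  fixes n n' :: nat
  assumes "n' < n" "p + x = n\<^sup>2" "x \<le> n" "p' + x' = n'\<^sup>2"
  shows "p' + (n - 1) \<le> p"
proof -
  obtain k where n: "n = Suc (n' + k)" using assms(1) less_imp_Suc_add by blast
  have "n\<^sup>2 \<ge> n'\<^sup>2 + (n - 1) + n"
    unfolding n by (simp add: power2_eq_square algebra_simps)
  then show ?thesis using assms by linarith
qed

lemma pattern_gap:
  assumes "x \<in> pattern A" "y \<in> pattern A" "x < y"
  shows "y \<ge> x + 4 \<or> x = 0 \<and> y = 3"
  using assms by (auto simp: pattern_def)

lemma sites_gap:
  assumes "p \<in> sites A" "p' \<in> sites A" "p' < p"
  shows "p \<ge> p' + 4 \<or> p = p' + 3 \<and> (\<exists>n\<ge>5. p = n\<^sup>2)"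
proof -
  obtain n x where n: "n \<ge> 5" "x \<le> n" "x \<in> pattern A" "p + x = n\<^sup>2" using assms by (auto simp: sites_def)
  obtain n' x' where n': "n' \<ge> 5" "x' \<le> n'" "x' \<in> pattern A" "p' + x' = n'\<^sup>2" using assms by (auto simp: sites_def)
  consider "n' < n" | "n < n'" | "n = n'" by linarith
  then show ?thesis
  proof cases
    case 1
    then show ?thesis using square_gap[OF 1 n(4,2) n'(4)] n by linarith
  next
    case 2
    then show ?thesis using square_gap[OF 2 n'(4,2) n(4)] assms(3) by linarith
  next
    case 3
    then have "p + x = p' + x'" using n n' by simp
    then have "x < x'" using assms(3) by linarith
    then show ?thesis using pattern_gap[OF n(3) n'(3)] n n' 3 by auto
  qed
qed

lemma sparse_sites: "sparse (sites A)"
  unfolding sparse_def using sites_gap[of _ A] by fastforce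

text \<open>The blocks of other squares are too far away to interfere.\<close>

lemma square_sites:
  assumes "n \<ge> 5" "j < n"
  shows "n\<^sup>2 - Suc j \<in> sites A \<longleftrightarrow> Suc j \<in> pattern A"
proof
  have le: "Suc j \<le> n\<^sup>2"
    using assms self_le_power[of n 2] by linarith
  {
    assume "n\<^sup>2 - Suc j \<in> sites A"
    then obtain n' x' where n': "n' \<ge> 5" "x' \<le> n'" "x' \<in> pattern A" "n\<^sup>2 - Suc j + x' = n'\<^sup>2" by (auto simp: sites_def)
    have e: "n\<^sup>2 - Suc j + Suc j = n\<^sup>2" using le by simp
    consider "n' < n" | "n < n'" | "n = n'" by linarith
    then show "Suc j \<in> pattern A"
    proof cases
      case 1
      then show ?thesis using square_gap[OF 1 e _ n'(4)] assms by linarith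
    next
      case 2
      then show ?thesis using square_gap[OF 2 n'(4,2) e] assms n' by linarith
    next
      case 3
      have "Suc j = x'" using e n'(4) unfolding 3 by linarith
      then show ?thesis using n' by simp
    qed
  }
  assume "Suc j \<in> pattern A"
  then show "n\<^sup>2 - Suc j \<in> sites A" using assms le unfolding sites_def by (intro CollectI exI[of _ n] exI[of _ "Suc j"]) auto
qed

lemma summable_binary: "summable (\<lambda>j. of_bool (Q j) / 2 ^ Suc j :: real)"
proof (rule summable_comparison_test)
  show "summable (\<lambda>j. (1 / 2) ^ j :: real)" by (simp add: summable_geometric)
  show "\<exists>N. \<forall>j\<ge>N. norm (of_bool (Q j) / 2 ^ Suc j :: real) \<le> (1 / 2) ^ j"
    by (auto simp: power_divide field_simps)
qed

lemma binary_suminf_bounds: "0 \<le> (\<Sum>j. of_bool (Q j) / 2 ^ Suc j :: real)" "(\<Sum>j. of_bool (Q j) / 2 ^ Suc j :: real) \<le> 1"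
proof -
  show "0 \<le> (\<Sum>j. of_bool (Q j) / 2 ^ Suc j :: real)" by (intro suminf_nonneg summable_binary) simp
  have "(\<Sum>j. of_bool (Q j) / 2 ^ Suc j :: real) \<le> (\<Sum>j. of_bool True / 2 ^ Suc j)"
    by (intro suminf_le summable_binary) (auto simp: divide_right_mono)
  also have "\<dots> = (\<Sum>j. (1 / 2) ^ Suc j)" by (simp add: power_divide)
  also have "\<dots> = 1" using power_half_series by (simp add: sums_iff)
  finally show "(\<Sum>j. of_bool (Q j) / 2 ^ Suc j :: real) \<le> 1" .
qed

lemma past_weight_square:
  assumes "n \<ge> 5"
  shows "past_weight (sites A) (n\<^sup>2) =
    past_weight (sites A) (n\<^sup>2 - n) / 2 ^ n + (\<Sum>j<n. of_bool (Suc j \<in> pattern A) / 2 ^ Suc j)"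
proof -
  have e: "n\<^sup>2 - n + n = n\<^sup>2" by (simp add: power2_eq_square)
  show ?thesis
    using past_weight_add[of "sites A" "n\<^sup>2 - n" n] square_sites[OF assms] unfolding e
    by (simp del: power_Suc cong: sum.cong_simp)
qed

text \<open>Everything older than the block is divided by \<open>2 ^ n\<close>, so only the pattern
  digits survive. The offset \<open>5\<close> skips the squares without a block.\<close>

lemma past_weight_square_tendsto:
  "(\<lambda>n. past_weight (sites A) ((n + 5)\<^sup>2)) \<longlonglongrightarrow> pattern_value A"
proof -
  have "(\<lambda>n. \<Sum>j<n. of_bool (Suc j \<in> pattern A) / 2 ^ Suc j) \<longlonglongrightarrow> pattern_value A"
    unfolding pattern_value_def by (rule summable_LIMSEQ[OF summable_binary])
  moreover have "(\<lambda>n. past_weight (sites A) (n\<^sup>2 - n) / 2 ^ n) \<longlonglongrightarrow> 0"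
  proof (rule tendsto_sandwich[where f = "\<lambda>_. 0" and h = "\<lambda>n. (1 / 2) ^ n"])
    show "(\<lambda>n. (1 / 2) ^ n :: real) \<longlonglongrightarrow> 0" by (simp add: LIMSEQ_power_zero)
    show "\<forall>\<^sub>F n in sequentially. past_weight (sites A) (n\<^sup>2 - n) / 2 ^ n \<le> (1 / 2) ^ n"
      using past_weight_bounds by (auto simp: power_divide divide_right_mono)
    show "\<forall>\<^sub>F n in sequentially. 0 \<le> past_weight (sites A) (n\<^sup>2 - n) / 2 ^ n"
      using past_weight_bounds by auto
  qed simp
  ultimately have "(\<lambda>n. past_weight (sites A) (n\<^sup>2 - n) / 2 ^ n + (\<Sum>j<n. of_bool (Suc j \<in> pattern A) / 2 ^ Suc j)) \<longlonglongrightarrow> 0 + pattern_value A"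
    by (intro tendsto_add)
  from LIMSEQ_ignore_initial_segment[OF this, of 5] show ?thesis
    using past_weight_square[of "n + 5" A for n] by simp
qed

lemma pattern_value_ge: "1 / 8 \<le> pattern_value A"
proof -
  have "(\<Sum>j<3. of_bool (Suc j \<in> pattern A) / 2 ^ Suc j :: real) \<le> pattern_value A"
    unfolding pattern_value_def by (intro sum_le_suminf summable_binary) auto
  moreover have "Suc (Suc (Suc 0)) \<in> pattern A" by (simp add: pattern_def numeral_3_eq_3)
  ultimately show ?thesis by (simp add: eval_nat_numeral split: split_of_bool_asm)
qed

lemma past_weight_sites_le:
  assumes e: "e > 0"
  shows "\<forall>\<^sub>F m in sequentially. m \<in> sites A \<longrightarrow> past_weight (sites A) m \<le> pattern_value A + e"
proof -
  obtain N where N: "\<And>n. n \<ge> N \<Longrightarrow> past_weight (sites A) ((n + 5)\<^sup>2) < pattern_value A + e"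
    using order_tendstoD(2)[OF past_weight_square_tendsto, of A "pattern_value A + e"] e
    by (auto simp: eventually_sequentially)
  have "past_weight (sites A) m \<le> pattern_value A + e" if m: "m \<ge> (N + 5)\<^sup>2" "m \<in> sites A" for m
  proof (cases "\<exists>n\<ge>5. m = n\<^sup>2")
    case True
    then obtain n where n: "n \<ge> 5" "m = n\<^sup>2" by blast
    then have "N + 5 \<le> n" using m by (simp add: power2_nat_le_eq_le)
    then have "N \<le> n - 5" "n - 5 + 5 = n" using n by linarith+
    then show ?thesis using N[of "n - 5"] n by simp
  next
    case False
    have ge: "m \<ge> 25" using m(1) power_mono[of 5 "N + 5" 2] by simp
    define k where "k = m - 3"
    have k: "m = k + 3" using ge by (simp add: k_def)
    \<comment> \<open>A site that is not a square has no site among the three positions below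
      it.\<close>
    have "i \<notin> sites A" if "i < m" "i \<ge> k" for i
      using sites_gap[OF m(2) _ that(1)] False that(2) k by auto
    then have "past_weight (sites A) m = past_weight (sites A) k / 8"
      using past_weight_add[of "sites A" k 3] k by (simp add: eval_nat_numeral)
    then show ?thesis using past_weight_bounds(2)[of "sites A" k] pattern_value_ge[of A] e by simp
  qed
  then show ?thesis unfolding eventually_sequentially by blast
qed

text \<open>Ones in the pattern are isolated, so no number has two expansions: at the first
  difference the extra digit outweighs all that follows.\<close>

lemma inj_pattern_value: "inj pattern_value"
proof -
  have less: "pattern_value B < pattern_value A"
    if s: "s \<in> A" "s \<notin> B" "\<And>i. i < s \<Longrightarrow> i \<in> A \<longleftrightarrow> i \<in> B" for A B s
  proof -
    let ?f = "\<lambda>A j. of_bool (Suc j \<in> pattern A) / 2 ^ Suc j :: real"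
    \<comment> \<open>The digit of index \<open>k\<close> belongs to
      \<open>Suc k = 4 * s + 7\<close>. The next digit of \<open>B\<close> vanishes too, so its tail
      starts at \<open>k + 2\<close> and is strictly smaller than the digit gained.\<close>
    define k where "k = 4 * s + 6"
    have split: "pattern_value A = (\<Sum>j. ?f A (j + (k + 2))) + (\<Sum>j<k. ?f A j) + ?f A k + ?f A (Suc k)" for A
      unfolding pattern_value_def using suminf_split_initial_segment[OF summable_binary[of "\<lambda>j. Suc j \<in> pattern A"], of "k + 2"] by simp
    have tail: "(\<Sum>j. ?f A (j + (k + 2))) = (\<Sum>j. of_bool (Suc (j + (k + 2)) \<in> pattern A) / 2 ^ Suc j) / 2 ^ (k + 2)" for A
      by (subst suminf_divide[OF summable_binary, symmetric]) (simp add: power_add field_simps)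
    have "(\<Sum>j. ?f B (j + (k + 2))) \<le> 1 / 2 ^ (k + 2)" "(\<Sum>j. ?f A (j + (k + 2))) \<ge> 0"
      unfolding tail by (intro divide_right_mono divide_nonneg_nonneg binary_suminf_bounds; simp)+
    moreover have "(\<Sum>j<k. ?f A j) = (\<Sum>j<k. ?f B j)"
      using s(3) by (intro sum.cong) (auto simp: pattern_def k_def)
    moreover have "Suc k \<in> pattern A" "Suc k \<notin> pattern B" "Suc (Suc k) \<notin> pattern B"
      using s by (auto simp: pattern_def k_def; presburger)+
    moreover from this have "?f A k = 1 / 2 ^ Suc k" "?f B k = 0" "?f B (Suc k) = 0" "?f A (Suc k) \<ge> 0"
      by simp_all
    moreover have "(1 :: real) / 2 ^ (k + 2) < 1 / 2 ^ Suc k" by (simp add: field_simps)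
    ultimately show ?thesis unfolding split[of A] split[of B] by linarith
  qed
  show ?thesis
  proof (rule injI, rule ccontr)
    fix A B assume e: "pattern_value A = pattern_value B" and ne: "A \<noteq> B"
    then obtain s0 where "(s0 \<in> A) \<noteq> (s0 \<in> B)" by blast
    then obtain s where "(s \<in> A) \<noteq> (s \<in> B)" "\<And>i. i < s \<Longrightarrow> (i \<in> A) = (i \<in> B)"
      using exists_least_iff[of "\<lambda>s. (s \<in> A) \<noteq> (s \<in> B)"] by blast
    then show False using less[of s A B] less[of s B A] e by auto
  qed
qed

section \<open>From the spinal group to its truncations\<close>

text \<open>For an involution, preserving edges in one direction suffices: a second application
  gives the converse.\<close>

lemma tree_aut_involution:
  assumes "g [] = []" "\<And>v. g (g v) = v" "\<And>w x. \<exists>y. g (w @ [x]) = g w @ [y]"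
  shows "g \<in> tree_aut"
proof -
  have "\<exists>x. v = u @ [x]" if "g v = g u @ [y]" for u v y
    using assms(3)[of "g u" y] assms(2)[of u] assms(2)[of v] that by auto
  moreover have "bij g" using assms(2) by (metis bij_iff)
  ultimately show ?thesis using assms(1,3) unfolding tree_aut_def by blast
qed

lemma tree_aut_id: "id \<in> tree_aut"
  by (auto simp: tree_aut_def)

lemma tree_aut_comp: "g \<in> tree_aut \<Longrightarrow> h \<in> tree_aut \<Longrightarrow> g \<circ> h \<in> tree_aut"
  by (simp add: tree_aut_def bij_comp)

lemma tree_aut_edge: "g \<in> tree_aut \<Longrightarrow> \<exists>y. g (w @ [x]) = g w @ [y]"
  by (simp add: tree_aut_def)

lemma tree_aut_Nil: "g \<in> tree_aut \<Longrightarrow> g [] = []"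
  by (simp add: tree_aut_def)

lemma tree_aut_length: "g \<in> tree_aut \<Longrightarrow> length (g v) = length v"
proof (induction v rule: rev_induct)
  case (snoc x v)
  then show ?case using tree_aut_edge[of g v x] by auto
qed (simp add: tree_aut_Nil)

lemma tree_aut_prefix: "g \<in> tree_aut \<Longrightarrow> take (length v) (g (v @ w)) = g v"
proof (induction w rule: rev_induct)
  case Nil
  then show ?case by (simp add: tree_aut_length)
next
  case (snoc x w)
  then show ?case using tree_aut_edge[of g "v @ w" x] by (auto simp: tree_aut_length)
qed

lemma swap_pow_simps [simp]: "swap_pow t [] = []" "swap_pow t (x # w) = (x + t) # w"
  by (simp_all add: swap_pow_def decomp_def)

lemma swap_pow_involution: "swap_pow t (swap_pow t v) = v"
  using bit_cases[of t] by (cases v) auto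

lemma swap_pow_edge: "\<exists>y. swap_pow t (w @ [x]) = swap_pow t w @ [y]"
  by (cases w) auto

lemma swap_pow_tree_aut: "swap_pow t \<in> tree_aut"
  using swap_pow_involution swap_pow_edge by (intro tree_aut_involution) auto

lemma spinal_act_involution: "spinal_act \<omega> b (spinal_act \<omega> b v) = v"
proof (induction v arbitrary: \<omega>)
  case (Cons x w)
  then show ?case using bit_cases[of x] by (auto simp: swap_pow_involution)
qed simp

lemma spinal_act_edge: "\<exists>y. spinal_act \<omega> b (w @ [x]) = spinal_act \<omega> b w @ [y]"
proof (induction w arbitrary: \<omega>)
  case (Cons a w)
  then show ?case using swap_pow_edge by auto
qed auto

lemma spinal_act_tree_aut: "spinal_act \<omega> b \<in> tree_aut"
  using spinal_act_involution spinal_act_edge by (intro tree_aut_involution) auto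

lemma Aut_tree_simps:
  "\<one>\<^bsub>Aut_tree\<^esub> = id" "carrier Aut_tree = tree_aut"
  "g \<in> tree_aut \<Longrightarrow> h \<in> tree_aut \<Longrightarrow> g \<otimes>\<^bsub>Aut_tree\<^esub> h = g \<circ> h"
  by (auto simp: Aut_tree_def BijGroup_def Bij_def tree_aut_def compose_def fun_eq_iff)

lemma inv_Aut_tree_involution:
  assumes "g \<in> tree_aut" "g \<circ> g = id"
  shows "inv\<^bsub>Aut_tree\<^esub> g = g"
  unfolding m_inv_def
proof (rule the_equality)
  show "g \<in> carrier Aut_tree \<and> g \<otimes>\<^bsub>Aut_tree\<^esub> g = \<one>\<^bsub>Aut_tree\<^esub> \<and> g \<otimes>\<^bsub>Aut_tree\<^esub> g = \<one>\<^bsub>Aut_tree\<^esub>"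
    using assms by (simp add: Aut_tree_simps)
next
  fix y assume "y \<in> carrier Aut_tree \<and> g \<otimes>\<^bsub>Aut_tree\<^esub> y = \<one>\<^bsub>Aut_tree\<^esub> \<and> y \<otimes>\<^bsub>Aut_tree\<^esub> g = \<one>\<^bsub>Aut_tree\<^esub>"
  then have "y \<in> tree_aut" "g \<otimes>\<^bsub>Aut_tree\<^esub> y = id" by (simp_all add: Aut_tree_simps)
  then have "g \<circ> y = id" using assms by (simp add: Aut_tree_simps)
  then have "g \<circ> (g \<circ> y) = g" by simp
  then show "y = g" using assms by (simp add: comp_assoc[symmetric])
qed

section \<open>Level quotients as sets of truncations\<close>

definition truncate :: "nat \<Rightarrow> (bit list \<Rightarrow> bit list) \<Rightarrow> tree_map" where
  "truncate m g = Map (\<lambda>v. g (take m v) @ drop m v)"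

lemma truncate_eq_iff:
  assumes "g \<in> tree_aut" "h \<in> tree_aut"
  shows "truncate m g = truncate m h \<longleftrightarrow> (\<forall>v. length v = m \<longrightarrow> g v = h v)"
proof
  assume "truncate m g = truncate m h"
  then have "(\<lambda>v. g (take m v) @ drop m v) = (\<lambda>v. h (take m v) @ drop m v)"
    unfolding truncate_def by simp
  then have "g (take m v) @ drop m v = h (take m v) @ drop m v" for v by meson
  then show "\<forall>v. length v = m \<longrightarrow> g v = h v" by (metis append_same_eq order_refl take_all)
next
  assume e: "\<forall>v. length v = m \<longrightarrow> g v = h v"
  have "g v = h v" if "length v \<le> m" for v
  proof -
    \<comment> \<open>Shorter words are padded to length \<open>m\<close>; preservation of prefixes
      then discards the padding.\<close>
    have "g (v @ replicate (m - length v) 0) = h (v @ replicate (m - length v) 0)" using that e by simp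
    then show ?thesis using tree_aut_prefix assms by metis
  qed
  then show "truncate m g = truncate m h" by (simp add: truncate_def)
qed

lemma truncate_id: "truncate m id = 1"
  by (simp add: truncate_def one_tree_map_def id_def)

lemma truncate_comp:
  assumes "g \<in> tree_aut" "h \<in> tree_aut"
  shows "truncate m (g \<circ> h) = truncate m g * truncate m h"
proof -
  have "g (h (take m v)) @ drop m v = g (take m (h (take m v) @ drop m v)) @ drop m (h (take m v) @ drop m v)" for v
    using assms by (cases "length v \<ge> m") (simp_all add: tree_aut_length)
  then show ?thesis by (simp add: truncate_def times_tree_map_def fun_eq_iff)
qed

locale tree_involutions =
  fixes X :: "(bit list \<Rightarrow> bit list) set"
  assumes X: "\<And>x. x \<in> X \<Longrightarrow> x \<in> tree_aut" "\<And>x. x \<in> X \<Longrightarrow> x \<circ> x = id"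
begin

abbreviation "GX \<equiv> generate Aut_tree X"

lemma GX_tree_aut: "g \<in> GX \<Longrightarrow> g \<in> tree_aut"
proof (induction rule: generate.induct)
  case one
  show ?case unfolding Aut_tree_simps(1) by (rule tree_aut_id)
next
  case (incl h)
  then show ?case by (rule X)
next
  case (inv h)
  then show ?case unfolding inv_Aut_tree_involution[OF X[OF inv]] by (intro X)
next
  case (eng g h)
  then show ?case unfolding Aut_tree_simps(3)[OF eng(3,4)] by (intro tree_aut_comp)
qed

lemma GX_comp: "g \<in> GX \<Longrightarrow> h \<in> GX \<Longrightarrow> g \<circ> h \<in> GX"
  using generate.eng[of g Aut_tree X h] by (simp add: Aut_tree_simps GX_tree_aut)

lemma GX_id: "id \<in> GX"
  using generate.one[of Aut_tree X] by (simp add: Aut_tree_simps)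

lemma GX_induct [consumes 1, case_names id gen comp]:
  assumes "g \<in> GX" "P id" "\<And>x. x \<in> X \<Longrightarrow> P x" "\<And>g h. g \<in> GX \<Longrightarrow> h \<in> GX \<Longrightarrow> P g \<Longrightarrow> P h \<Longrightarrow> P (g \<circ> h)"
  shows "P g"
  using assms(1)
proof (induction rule: generate.induct)
  case one
  show ?case unfolding Aut_tree_simps(1) by (rule assms(2))
next
  case (incl h)
  then show ?case by (rule assms(3))
next
  case (inv h)
  then show ?case unfolding inv_Aut_tree_involution[OF X[OF inv]] by (intro assms(3))
next
  case (eng g h)
  then show ?case unfolding Aut_tree_simps(3)[OF GX_tree_aut[OF eng(1)] GX_tree_aut[OF eng(2)]] by (intro assms(4))
qed

lemma GX_inverse: "g \<in> GX \<Longrightarrow> \<exists>h\<in>GX. g \<circ> h = id \<and> h \<circ> g = id"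
proof (induction rule: GX_induct)
  case id
  show ?case using GX_id by (intro bexI[of _ id]) simp_all
next
  case (gen x)
  have "x \<in> GX" by (rule generate.incl[OF gen])
  then show ?case using X(2)[OF gen] by (intro bexI[of _ x] conjI)
next
  case (comp g h)
  then obtain g' h' where gh: "g' \<in> GX" "h' \<in> GX" "g \<circ> g' = id" "g' \<circ> g = id" "h \<circ> h' = id" "h' \<circ> h = id" by blast
  have "(g \<circ> h) \<circ> (h' \<circ> g') = g \<circ> (h \<circ> h') \<circ> g'" "(h' \<circ> g') \<circ> (g \<circ> h) = h' \<circ> (g' \<circ> g) \<circ> h"
    by (simp_all only: comp_assoc)
  then have "(g \<circ> h) \<circ> (h' \<circ> g') = id" "(h' \<circ> g') \<circ> (g \<circ> h) = id" using gh by simp_all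
  then show ?case using GX_comp gh by blast
qed

lemma coset_eq: "h \<in> GX \<Longrightarrow> level_stab GX m #>\<^bsub>Aut_tree\<lparr>carrier := GX\<rparr>\<^esub> h = (\<lambda>g. g \<circ> h) ` level_stab GX m"
  by (auto simp: r_coset_def level_stab_def Aut_tree_simps GX_tree_aut image_iff)

lemma coset_eq_iff:
  assumes g: "g \<in> GX" and h: "h \<in> GX"
  shows "(\<lambda>k. k \<circ> g) ` level_stab GX m = (\<lambda>k. k \<circ> h) ` level_stab GX m \<longleftrightarrow> truncate m g = truncate m h"
proof -
  have sub: "(\<lambda>k. k \<circ> g) ` level_stab GX m \<subseteq> (\<lambda>k. k \<circ> h) ` level_stab GX m"
    if g: "g \<in> GX" and h: "h \<in> GX" and e: "\<forall>v. length v = m \<longrightarrow> g v = h v" for g h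
  proof
    fix x assume "x \<in> (\<lambda>k. k \<circ> g) ` level_stab GX m"
    then obtain k where k: "x = k \<circ> g" "k \<in> GX" "\<And>v. length v = m \<Longrightarrow> k v = v" by (auto simp: level_stab_def)
    obtain h' where h': "h' \<in> GX" "h \<circ> h' = id" "h' \<circ> h = id" using GX_inverse h by blast
    \<comment> \<open>This element fixes level \<open>m\<close>, because \<open>g\<close> and
      \<open>h\<close> agree there, and it rewrites \<open>k \<circ> g\<close> as a member of the
      coset of \<open>h\<close>.\<close>
    have "k \<circ> g \<circ> h' \<in> GX" using k g h' GX_comp by blast
    moreover have "(k \<circ> g \<circ> h') v = v" if v: "length v = m" for v
    proof -
      have "length (h' v) = m" using tree_aut_length GX_tree_aut h' v by metis
      then have "g (h' v) = h (h' v)" using e by blast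
      also have "\<dots> = v" using h' by (metis comp_apply id_apply)
      finally show ?thesis using k v by simp
    qed
    moreover have "x = (k \<circ> g \<circ> h') \<circ> h" using h'(3) k by (simp add: comp_assoc)
    ultimately show "x \<in> (\<lambda>k. k \<circ> h) ` level_stab GX m" by (auto simp: level_stab_def)
  qed
  have agree: "\<forall>v. length v = m \<longrightarrow> g v = h v" if e: "(\<lambda>k. k \<circ> g) ` level_stab GX m = (\<lambda>k. k \<circ> h) ` level_stab GX m"
  proof -
    have "id \<in> level_stab GX m" using GX_id by (simp add: level_stab_def)
    then have "id \<circ> g \<in> (\<lambda>k. k \<circ> g) ` level_stab GX m" by (rule imageI)
    then have "g \<in> (\<lambda>k. k \<circ> h) ` level_stab GX m" using e by simp
    then obtain k where "g = k \<circ> h" "\<And>v. length v = m \<Longrightarrow> k v = v" by (auto simp: level_stab_def)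
    then show ?thesis using tree_aut_length GX_tree_aut h by simp
  qed
  show ?thesis
    unfolding truncate_eq_iff[OF GX_tree_aut[OF g] GX_tree_aut[OF h]]
  proof
    assume "\<forall>v. length v = m \<longrightarrow> g v = h v"
    then show "(\<lambda>k. k \<circ> g) ` level_stab GX m = (\<lambda>k. k \<circ> h) ` level_stab GX m"
      by (intro equalityI sub g h) simp_all
  qed (rule agree)
qed

lemma card_level_quot: "card (carrier (level_quot GX m)) = card (truncate m ` GX)"
proof -
  have c: "carrier (level_quot GX m) = (\<lambda>h. (\<lambda>g. g \<circ> h) ` level_stab GX m) ` GX"
    unfolding level_quot_def FactGroup_def RCOSETS_def using coset_eq by auto
  \<comment> \<open>Each truncation is sent to the coset of a chosen preimage; by
    \<open>coset_eq_iff\<close> the coset does not depend on the choice.\<close>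
  have b: "bij_betw (\<lambda>t. (\<lambda>g. g \<circ> (SOME h. h \<in> GX \<and> truncate m h = t)) ` level_stab GX m)
    (truncate m ` GX) ((\<lambda>h. (\<lambda>g. g \<circ> h) ` level_stab GX m) ` GX)"
  proof -
    have S: "(SOME h. h \<in> GX \<and> truncate m h = truncate m k) \<in> GX \<and>
        truncate m (SOME h. h \<in> GX \<and> truncate m h = truncate m k) = truncate m k" if "k \<in> GX" for k
      by (rule someI[where x = k]) (use that in auto)
    then have e: "(\<lambda>g. g \<circ> (SOME h. h \<in> GX \<and> truncate m h = truncate m k)) ` level_stab GX m = (\<lambda>g. g \<circ> k) ` level_stab GX m"
      if "k \<in> GX" for k
      using coset_eq_iff that by blast
    show ?thesis
    proof (rule bij_betw_imageI)
      show "inj_on (\<lambda>t. (\<lambda>g. g \<circ> (SOME h. h \<in> GX \<and> truncate m h = t)) ` level_stab GX m) (truncate m ` GX)"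
        unfolding inj_on_def using e coset_eq_iff by auto
      show "(\<lambda>t. (\<lambda>g. g \<circ> (SOME h. h \<in> GX \<and> truncate m h = t)) ` level_stab GX m) ` truncate m ` GX =
        (\<lambda>h. (\<lambda>g. g \<circ> h) ` level_stab GX m) ` GX"
        unfolding image_image by (rule image_cong[OF refl e])
    qed
  qed
  show ?thesis unfolding c by (rule bij_betw_same_card[OF b, symmetric])
qed

end

section \<open>Dimensions of two-letter spinal groups\<close>

lemma repeats_shift: "repeats (shift s) = {i. Suc i \<in> repeats s}"
  by (simp add: repeats_def shift_def)

lemma shift_pow: "(shift ^^ m) s i = s (m + i)"
  by (induction m arbitrary: i) (simp_all add: shift_def)

lemma sparse_shift: "sparse (repeats s) \<Longrightarrow> sparse (repeats (shift s))"
  by (auto simp: sparse_def repeats_shift)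

text \<open>Iterating \<open>level_log_Suc\<close>, the constant \<open>2\<close> sums to the
  geometric part \<open>1 / 8 - 1 / (8 * 2 ^ m)\<close> and the repetitions sum to the past
  weight.\<close>

lemma level_log_ratio:
  assumes "sparse (repeats s)"
  shows "level_log (m + 4) s / 2 ^ (m + 4) =
    level_log 4 ((shift ^^ m) s) / 16 - 1 / 8 + 1 / (8 * 2 ^ m) - past_weight (repeats s) m / 16"
  using assms
proof (induction m arbitrary: s)
  case (Suc m)
  have sp: "i \<in> repeats s \<Longrightarrow> Suc i \<notin> repeats s \<and> Suc (Suc i) \<notin> repeats s" for i
    using Suc.prems by (auto simp: sparse_def)
  have e: "level_log (Suc (m + 4)) s = 2 * level_log (m + 4) (shift s) - (2 + of_bool (0 \<in> repeats s))"
    by (rule level_log_Suc) (use sp[of 0] sp[of 1] in \<open>auto simp: numeral_2_eq_2\<close>)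
  have "level_log (Suc m + 4) s / 2 ^ (Suc m + 4) =
    level_log (m + 4) (shift s) / 2 ^ (m + 4) - (2 + of_bool (0 \<in> repeats s)) / (32 * 2 ^ m)"
    unfolding add_Suc e by (simp add: power_add field_simps)
  also have "level_log (m + 4) (shift s) / 2 ^ (m + 4) =
    level_log 4 ((shift ^^ m) (shift s)) / 16 - 1 / 8 + 1 / (8 * 2 ^ m) - past_weight (repeats (shift s)) m / 16"
    using Suc.prems by (intro Suc.IH sparse_shift)
  also have "(shift ^^ m) (shift s) = (shift ^^ Suc m) s" by (simp only: funpow_Suc_right o_apply)
  finally show ?case
    unfolding past_weight_Suc_front repeats_shift by (simp add: field_simps)
qed simp

lemma ray_cong: "(\<And>i. Suc i < m \<Longrightarrow> s i = t i) \<Longrightarrow> ray m s = ray m t"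
proof (induction m arbitrary: s t)
  case (Suc m)
  have "ray m (shift s) = ray m (shift t)" using Suc.prems by (intro Suc.IH) (simp add: shift_def)
  moreover have "flip m (s 0) = flip m (t 0)" using Suc.prems[of 0] by (cases m) (simp_all add: flip_def)
  ultimately show ?case by simp
qed simp

lemma level_log_cong:
  assumes "\<And>i. Suc i < m \<Longrightarrow> s i = t i"
  shows "level_log m s = level_log m t"
proof -
  have "ray m s = ray m t" "ray m (1 + s) = ray m (1 + t)"
    using assms by (intro ray_cong; simp)+
  then show ?thesis unfolding level_log_def by (simp only:)
qed

text \<open>Representative with first letter \<open>0\<close> and prescribed repetitions at
  \<open>0\<close> and \<open>1\<close>. On level \<open>4\<close> only the first three letters are
  visible.\<close>

definition letter_pattern :: "bool \<Rightarrow> bool \<Rightarrow> nat \<Rightarrow> bit" where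
  "letter_pattern x y i = (if i = 0 then 0 else if i = 1 then of_bool (\<not> x) else of_bool (x \<noteq> y))"

lemma level_log_4: "level_log 4 s = level_log 4 (letter_pattern (0 \<in> repeats s) (1 \<in> repeats s))"
proof -
  have zero: "level_log 4 s = level_log 4 (letter_pattern (0 \<in> repeats s) (1 \<in> repeats s))" if "s 0 = 0" for s
  proof (rule level_log_cong)
    fix i :: nat assume "Suc i < 4"
    then consider "i = 0" | "i = 1" | "i = 2" by linarith
    then show "s i = letter_pattern (0 \<in> repeats s) (1 \<in> repeats s) i"
      using that bit_cases[of "s 1"] bit_cases[of "s 2"]
      by cases (auto simp: letter_pattern_def repeats_def numeral_2_eq_2)
  qed
  show ?thesis
  proof (cases "s 0 = 0")
    case False
    then have "(1 + s) 0 = 0" using bit_cases[of "s 0"] by simp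
    from zero[of "1 + s", OF this] show ?thesis unfolding level_log_complement repeats_complement .
  qed (rule zero)
qed

fun letters :: "nat set \<Rightarrow> nat \<Rightarrow> bit" where
  "letters R 0 = 0"
| "letters R (Suc i) = (if i \<in> R then letters R i else 1 + letters R i)"

lemma repeats_letters: "repeats (letters R) = R"
proof -
  have "x \<noteq> 1 + x" for x :: bit using bit_cases[of x] by auto
  then show ?thesis by (auto simp: repeats_def simp del: add_bit_eq_xor)
qed

section \<open>Sequences over two coordinate functionals\<close>

definition two_letters :: "'n::finite \<Rightarrow> 'n \<Rightarrow> (nat \<Rightarrow> bit) \<Rightarrow> nat \<Rightarrow> bit ^ 'n \<Rightarrow> bit" where
  "two_letters i j u k b = (if u k = 0 then b $ i else b $ j)"

lemma truncate_swap_pow: "truncate m (swap_pow t) = flip m t"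
proof -
  have "swap_pow t (take m v) @ drop m v = (if m = 0 then v else decomp id id t v)" for v
    by (cases m; cases v) (simp_all add: decomp_def)
  then show ?thesis
    by (auto simp: truncate_def flip_def node_def one_tree_map_def id_def)
qed

lemma truncate_spinal_act: "truncate m (spinal_act \<omega> b) = ray m (\<lambda>k. \<omega> k b)"
proof (induction m arbitrary: \<omega>)
  case 0
  then show ?case by (simp add: truncate_def one_tree_map_def id_def)
next
  case (Suc m)
  have "spinal_act \<omega> b (take (Suc m) v) @ drop (Suc m) v =
    decomp (apply_map (truncate m (swap_pow (\<omega> 0 b)))) (apply_map (truncate m (spinal_act (shift \<omega>) b))) 0 v" for v
    using bit_cases[of "hd v"] by (cases v) (auto simp: decomp_def truncate_def)
  then have "truncate (Suc m) (spinal_act \<omega> b) =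
    node (truncate m (swap_pow (\<omega> 0 b))) (truncate m (spinal_act (shift \<omega>) b)) 0"
    unfolding truncate_def[of "Suc m"] node_def by presburger
  then show ?case by (simp add: truncate_swap_pow Suc shift_def)
qed

text \<open>The values \<open>x\<close>, \<open>y\<close> of the two functionals leave the sequences
  \<open>0\<close>, \<open>u\<close>, \<open>1 + u\<close> and their sum
  \<open>u + (1 + u)\<close>.\<close>

lemma ray_linear_combination:
  "ray m (\<lambda>k. if u k = 0 then x else y) \<in> {1, ray m u, ray m (1 + u), ray m u * ray m (1 + u)}"
proof -
  have "(\<lambda>k. if u k = 0 then x else y) = (if x = 0 then (if y = 0 then 0 else u) else (if y = 0 then 1 + u else u + (1 + u)))"
    using bit_cases[of x] bit_cases[of y] bit_cases[of "u k" for k] by (auto simp: fun_eq_iff)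
  then show ?thesis by (simp add: ray_mult del: add_bit_eq_xor)
qed

lemma tree_involutions_spinal: "tree_involutions (insert (swap_pow 1) (range (spinal_act \<omega>)))"
proof
  fix x assume x: "x \<in> insert (swap_pow 1) (range (spinal_act \<omega>))"
  show "x \<in> tree_aut"
    using x by (elim insertE rangeE) (simp_all only: swap_pow_tree_aut spinal_act_tree_aut)
  have "swap_pow 1 \<circ> swap_pow 1 = id" "\<And>b. spinal_act \<omega> b \<circ> spinal_act \<omega> b = id"
    by (simp_all add: fun_eq_iff swap_pow_involution spinal_act_involution)
  then show "x \<circ> x = id"
    using x by (elim insertE rangeE) (simp_all only:)
qed

lemma truncate_spinal_group:
  assumes "i \<noteq> j"
  shows "truncate m ` spinal_group (two_letters i j u) = spinal_quot m u"
proof -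
  let ?w = "two_letters i j u" and ?X = "insert (swap_pow 1) (range (spinal_act (two_letters i j u)))"
  interpret tree_involutions ?X
    by (rule tree_involutions_spinal)
  have G: "spinal_group ?w = GX" by (simp add: spinal_group_def)
  interpret I: three_involutions "flip m 1" "ray m u" "ray m (1 + u)" by (rule three_involutions_tree)
  have 1: "truncate m g \<in> spinal_quot m u" if "g \<in> GX" for g
    using that
  proof (induction rule: GX_induct)
    case id
    show ?case unfolding truncate_id by (rule gen_group.gen_group_one)
  next
    case (gen x)
    then consider "x = swap_pow 1" | b where "x = spinal_act ?w b" by blast
    then show ?case
    proof cases
      case 1
      show ?thesis unfolding 1 truncate_swap_pow by (rule I.Gr_gens)
    next
      case 2
      have "ray m (\<lambda>k. ?w k b) \<in> {1, ray m u, ray m (1 + u), ray m u * ray m (1 + u)}"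
        unfolding two_letters_def by (rule ray_linear_combination)
      then show ?thesis
        unfolding 2 truncate_spinal_act
        using I.Gr_gens I.Gr_comp[OF I.Gr_gens(2,3)] gen_group.gen_group_one[of "flip m 1"]
        by (elim insertE emptyE) (simp_all only:)
    qed
  next
    case (comp g h)
    then show ?case unfolding truncate_comp[OF GX_tree_aut GX_tree_aut, OF comp(1,2)] by (intro I.Gr_comp)
  qed
  have gens: "x \<in> truncate m ` GX" if "x \<in> {flip m 1, ray m u, ray m (1 + u)}" for x
  proof -
    \<comment> \<open>The two basis vectors separate the functionals: each is seen by exactly one of
      them.\<close>
    have "u = (\<lambda>k. ?w k (axis j 1))" "1 + u = (\<lambda>k. ?w k (axis i 1))"
      using assms bit_cases[of "u k" for k] by (auto simp: two_letters_def axis_def fun_eq_iff)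
    then have e: "ray m u = truncate m (spinal_act ?w (axis j 1))" "ray m (1 + u) = truncate m (spinal_act ?w (axis i 1))"
      unfolding truncate_spinal_act by simp_all
    have "?X \<subseteq> GX" by (auto intro: generate.incl)
    then show ?thesis using that unfolding e truncate_swap_pow[symmetric] by blast
  qed
  have 2: "x \<in> truncate m ` GX" if "x \<in> spinal_quot m u" for x
    using that
  proof induction
    case gen_group_one
    show ?case using GX_id truncate_id by (metis imageI)
  next
    case (gen_group_step x g)
    then obtain y h where "x = truncate m y" "g = truncate m h" "y \<in> GX" "h \<in> GX" using gens by blast
    then show ?case using truncate_comp[of y h m] GX_tree_aut GX_comp by (metis imageI)
  qed
  show ?thesis unfolding G using 1 2 by blast
qed

lemma hausdorff_dim_two_letters:
  assumes "i \<noteq> j"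
  shows "hausdorff_dim (spinal_group (two_letters i j u)) = liminf (\<lambda>m. ereal (level_log m u / 2 ^ m))"
proof -
  interpret tree_involutions "insert (swap_pow 1) (range (spinal_act (two_letters i j u)))"
    by (rule tree_involutions_spinal)
  have "card (carrier (level_quot (spinal_group (two_letters i j u)) m)) = card (spinal_quot m u)" for m
    using card_level_quot[of m] truncate_spinal_group[OF assms, of m u] unfolding spinal_group_def by simp
  then show ?thesis unfolding hausdorff_dim_def level_log_def by (simp only:)
qed

section \<open>Hausdorff dimension and lower dimension of the constructed sequences\<close>

definition dimension_value :: "real \<Rightarrow> real" where
  "dimension_value V =
    min (level_log 4 (letter_pattern True False) / 16 - 1 / 8 - V / 16)
      (min (level_log 4 (letter_pattern False True) / 16 - 1 / 8 - V / 8)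
        (level_log 4 (letter_pattern False False) / 16 - 1 / 8 - (1 + V) / 32))"

lemma dimension_value_less:
  assumes "V < V'"
  shows "dimension_value V' < dimension_value V"
proof -
  have m: "min x y < min x' y'" if "x < x'" "y < y'" for x y x' y' :: real
    using that by auto
  have "V' / 16 > V / 16" "V' / 8 > V / 8" "(1 + V') / 32 > (1 + V) / 32"
    using assms by simp_all
  then show ?thesis
    unfolding dimension_value_def by (intro m diff_strict_left_mono)
qed

lemma liminf_level_log:
  "liminf (\<lambda>m. ereal (level_log m (letters (sites A)) / 2 ^ m)) = ereal (dimension_value (pattern_value A))"
proof -
  let ?s = "letters (sites A)" and ?R = "sites A"
  define F where "F x y = level_log 4 (letter_pattern x y) / 16 - 1 / 8" for x y
  define d where "d m = 1 / (8 * 2 ^ m :: real)" for m :: nat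
  define p where "p n = (n + 5)\<^sup>2" for n :: nat
  have "level_log 4 ((shift ^^ m) ?s) / 16 - 1 / 8 = F (m \<in> ?R) (Suc m \<in> ?R)" for m
  proof -
    have "i \<in> repeats ((shift ^^ m) ?s) \<longleftrightarrow> m + i \<in> repeats ?s" for i
      by (simp add: repeats_def shift_pow)
    then have "0 \<in> repeats ((shift ^^ m) ?s) \<longleftrightarrow> m \<in> ?R" "1 \<in> repeats ((shift ^^ m) ?s) \<longleftrightarrow> Suc m \<in> ?R"
      by (simp_all add: repeats_letters)
    then show ?thesis unfolding F_def level_log_4[of "(shift ^^ m) ?s"] by simp
  qed
  then have ratio: "level_log (m + 4) ?s / 2 ^ (m + 4) = F (m \<in> ?R) (Suc m \<in> ?R) - past_weight ?R m / 16 + d m" for m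
    using level_log_ratio[of ?s m] sparse_sites[of A] by (simp add: repeats_letters d_def)
  have "liminf (\<lambda>m. ereal (level_log m ?s / 2 ^ m)) = liminf (\<lambda>m. ereal (level_log (m + 4) ?s / 2 ^ (m + 4)))"
    by (rule liminf_shift_k[symmetric])
  also have "\<dots> = liminf (\<lambda>m. ereal (F (m \<in> ?R) (Suc m \<in> ?R) - past_weight ?R m / 16 + d m))"
    unfolding ratio ..
  also have "\<dots> = ereal (min (F True False - pattern_value A / 16)
      (min (F False True - pattern_value A / 8) (F False False - (1 + pattern_value A) / 32)))"
  proof (rule liminf_past_weight[OF sparse_sites])
    show "strict_mono p" unfolding p_def by (intro strict_monoI power_strict_mono) auto
    show "p n \<in> ?R" for n
      unfolding sites_def p_def by (intro CollectI exI[of _ "n + 5"] exI[of _ 0]) (simp add: pattern_def)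
    show "(\<lambda>n. past_weight ?R (p n)) \<longlonglongrightarrow> pattern_value A"
      unfolding p_def by (rule past_weight_square_tendsto)
    show "d \<longlonglongrightarrow> 0" unfolding d_def
      using tendsto_mult_right_zero[OF LIMSEQ_power_zero[of "1 / 2 :: real"], of "1 / 8"] by (simp add: power_divide)
  qed (rule past_weight_sites_le)
  finally show ?thesis unfolding dimension_value_def F_def .
qed

text \<open>Beyond any point there is a position outside the sparse set, and there the letter
  changes.\<close>

lemma letters_value_infinitely_often: "\<exists>k\<ge>n. letters (sites A) k = x"
proof -
  have "\<exists>k\<ge>n. k \<notin> sites A" using sparse_sites[of A] unfolding sparse_def by (metis le_Suc_eq order_refl)
  then obtain k where k: "k \<ge> n" "k \<notin> sites A" by blast
  then have "letters (sites A) k = x \<or> letters (sites A) (Suc k) = x"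
    using bit_cases[of x] bit_cases[of "letters (sites A) k"] by auto
  then show ?thesis using k by (metis le_SucI)
qed

lemma coordinate_dual: "(\<lambda>b :: bit ^ 'n::finite. b $ i) \<in> dual_space - {0}"
proof -
  have "Vector_Spaces.linear (*s) (*) (\<lambda>b :: bit ^ 'n. b $ i)"
    unfolding Vector_Spaces.linear_iff
    by (intro conjI vec.vector_space_axioms vector_space_over_itself.vector_space_axioms) simp_all
  moreover have "(\<lambda>b :: bit ^ 'n. b $ i) (axis i 1) \<noteq> 0" by (simp add: axis_def)
  ultimately show ?thesis by (auto simp: dual_space_def fun_eq_iff simp del: axis_nth)
qed

lemma two_letters_eq: "two_letters i j u k = (if u k = 0 then (\<lambda>b. b $ i) else (\<lambda>b. b $ j))"
  by (auto simp: two_letters_def fun_eq_iff)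

lemma two_letters_Omega: "two_letters i j u \<in> Omega"
  using coordinate_dual unfolding Omega_def two_letters_eq by auto

lemma dim_two_coordinates:
  fixes i j :: "'n::finite"
  assumes "i \<noteq> j"
  shows "bitfun.dim (bitfun.span {\<lambda>b :: bit ^ 'n. b $ i, \<lambda>b. b $ j}) = 2"
proof -
  let ?f = "\<lambda>b :: bit ^ 'n. b $ i" and ?g = "\<lambda>b :: bit ^ 'n. b $ j"
  have ne: "?f (axis i 1) \<noteq> ?g (axis i 1)" using assms by (simp add: axis_def)
  then have fg: "?f \<noteq> ?g" by metis
  have f0: "?f \<noteq> 0" "?g \<noteq> 0" using coordinate_dual[of i] coordinate_dual[of j] by auto
  have "?f \<notin> bitfun.span {?g}"
  proof
    assume "?f \<in> bitfun.span {?g}"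
    then obtain c where "?f = fun_scale c ?g" by (auto simp: bitfun.span_singleton)
    then have "?f (axis i 1) = c * ?g (axis i 1)" by (metis fun_scale_def)
    then show False using assms by (simp add: axis_def)
  qed
  then have "bitfun.independent {?f, ?g}"
    using fg f0 by (simp add: bitfun.independent_insert bitfun.dependent_single)
  then have "bitfun.dim {?f, ?g} = card {?f, ?g}" by (rule bitfun.dim_eq_card_independent)
  then show ?thesis using fg by (simp add: bitfun.dim_span)
qed

text \<open>Every tail contains both functionals, so each inner limit is over an eventually constant
  sequence.\<close>

lemma lower_dim_two_letters:
  assumes "i \<noteq> j" and inf: "\<And>n x. \<exists>k\<ge>n. u k = x"
  shows "lower_dim (two_letters i j u) = 2"
proof -
  let ?w = "two_letters i j u"
  have "lim (\<lambda>m. enat (dim_mod ((shift ^^ l) ?w) m)) = 2" for l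
  proof -
    have sh: "(shift ^^ l) ?w k = ?w (l + k)" for k
      by (induction l arbitrary: k) (simp_all add: shift_def)
    obtain k k' where k: "k \<ge> l" "u k = 0" "k' \<ge> l" "u k' = 1" using inf by blast
    have "dim_mod ((shift ^^ l) ?w) m = 2" if "m \<ge> k + k' + 2" for m
    proof -
      have "k - l \<in> {..<m - 1}" "k' - l \<in> {..<m - 1}" using that by auto
      moreover have "(shift ^^ l) ?w (k - l) = (\<lambda>b. b $ i)" "(shift ^^ l) ?w (k' - l) = (\<lambda>b. b $ j)"
        using k by (simp_all add: sh two_letters_eq)
      ultimately have "{\<lambda>b. b $ i, \<lambda>b. b $ j} \<subseteq> (shift ^^ l) ?w ` {..<m - 1}"
        by (metis empty_subsetI imageI insert_subset)
      moreover have "(shift ^^ l) ?w ` {..<m - 1} \<subseteq> {\<lambda>b. b $ i, \<lambda>b. b $ j}"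
        by (auto simp: sh two_letters_eq)
      ultimately have "(shift ^^ l) ?w ` {..<m - 1} = {\<lambda>b. b $ i, \<lambda>b. b $ j}" by blast
      then show ?thesis unfolding dim_mod_def using dim_two_coordinates[OF assms(1)] by simp
    qed
    then have "\<forall>\<^sub>F m in sequentially. enat (dim_mod ((shift ^^ l) ?w) m) = 2"
      unfolding eventually_sequentially by (metis numeral_eq_enat)
    then have "(\<lambda>m. enat (dim_mod ((shift ^^ l) ?w) m)) \<longlonglongrightarrow> 2" by (rule tendsto_eventually)
    then show ?thesis by (rule limI)
  qed
  then show ?thesis unfolding lower_dim_def by (simp add: Liminf_const)
qed

section \<open>Transcendental dimensions\<close>

text \<open>There are countably many lists of integer coefficients, and each nonzero polynomial has
  finitely many roots.\<close>

lemma countable_algebraic: "countable {x :: real. algebraic x}"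
proof -
  have "{x :: real. algebraic x} \<subseteq> (\<Union>cs :: int list. {x. Poly (map real_of_int cs) \<noteq> 0 \<and> poly (Poly (map real_of_int cs)) x = 0})"
  proof
    fix x :: real assume "x \<in> {x. algebraic x}"
    then obtain q :: "real poly" where q: "\<And>i. coeff q i \<in> \<int>" "q \<noteq> 0" "poly q x = 0" by (auto simp: algebraic_def)
    have "\<forall>c \<in> set (coeffs q). c \<in> \<int>" using q(1) by (auto simp: coeffs_def)
    then have "map (of_int \<circ> floor) (coeffs q) = coeffs q"
      by (intro map_idI) (auto elim!: Ints_cases)
    then have "Poly (map real_of_int (map floor (coeffs q))) = q" by (simp add: Poly_coeffs)
    then show "x \<in> (\<Union>cs :: int list. {x. Poly (map real_of_int cs) \<noteq> 0 \<and> poly (Poly (map real_of_int cs)) x = 0})"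
      using q by (intro UN_I[of "map floor (coeffs q)"]) auto
  qed
  moreover have "countable \<dots>"
  proof (rule countable_UN[OF countableI_type], rule countable_finite)
    show "finite {x. q \<noteq> 0 \<and> poly q x = 0}" for q :: "real poly"
      by (cases "q = 0") (simp_all add: poly_roots_finite)
  qed
  ultimately show ?thesis by (rule countable_subset)
qed

lemma uncountable_nat_sets: "uncountable (UNIV :: nat set set)"
  unfolding uncountable_def using Cantors_theorem[of "UNIV :: nat set"] by (simp add: full_SetCompr_eq)

theorem corollary5p2:
  assumes "CARD('n::finite) \<ge> 2"
  shows "\<exists>x \<in> {l :: real. \<exists>\<omega> :: nat \<Rightarrow> bit ^ 'n \<Rightarrow> bit.
            \<omega> \<in> Omega \<and> lower_dim \<omega> = 2 \<and> hausdorff_dim (spinal_group \<omega>) = ereal l}.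
          \<not> algebraic x"
proof -
  obtain i j :: 'n where ij: "i \<noteq> j"
    using assms card_le_Suc0_iff_eq[of "UNIV :: 'n set"] by force
  \<comment> \<open>Distinct sets have distinct pattern values, on which the dimension depends
    strictly monotonically; hence uncountably many dimensions occur.\<close>
  have "inj (\<lambda>A. dimension_value (pattern_value A))"
    using inj_pattern_value dimension_value_less unfolding inj_def by (metis linorder_neqE less_irrefl)
  then have "uncountable (range (\<lambda>A. dimension_value (pattern_value A)))"
    using uncountable_nat_sets countable_image_inj_on by blast
  then have "\<not> range (\<lambda>A. dimension_value (pattern_value A)) \<subseteq> {x. algebraic x}"
    using countable_subset[OF _ countable_algebraic] by metis
  then obtain A where A: "\<not> algebraic (dimension_value (pattern_value A))" by auto
  have "hausdorff_dim (spinal_group (two_letters i j (letters (sites A)))) = ereal (dimension_value (pattern_value A))"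
    unfolding hausdorff_dim_two_letters[OF ij] by (rule liminf_level_log)
  moreover have "lower_dim (two_letters i j (letters (sites A))) = 2"
    by (rule lower_dim_two_letters[OF ij letters_value_infinitely_often])
  ultimately show ?thesis using A two_letters_Omega[of i j "letters (sites A)"] by blast
qed

end
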